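(* Let $X=\{1,2,3\}$, let $T(i)=X$ for each $i$, and define $\boldsymbol\psi(i,j)=(\mathbf{1}_{\{j=1\}},\mathbf{1}_{\{j=2\}})$. For $\beta\ge0$ and $\gamma\in\mathcal{M}(X^2)$ set $$\mathcal{E}_\beta(\gamma)=\frac\beta2\sum_{k=1}^3p_k^2,\qquad p_k:=\gamma(X\times\{k\}).$$ Then the rotation set is $\mathcal{R}(\boldsymbol\psi)=\{(p_1,p_2):p_1,p_2\ge0,\ p_1+p_2\le1\}$, and the critical inverse temperature is $\beta_c=4\log2$. The nonlinear equilibrium pairs are classified as follows, in terms of their equilibrium probability vectors $(p_1,p_2,p_3)$: (i) If $0\le\beta<\beta_c$, the unique equilibrium probability vector is $\boldsymbol{p}^{\mathrm{dis}}=(\frac13,\frac13,\frac13)$. (ii) If $\beta=\beta_c$, there are four equilibrium probability vectors: $\boldsymbol{p}^{\mathrm{dis}}$ and the three permutations of $(\frac23,\frac16,\frac16)$. (iii) If $\beta>\beta_c$, there are exactly three equilibrium probability vectors, namely the permutations of $(a_\beta,b_\beta,b_\beta)$, with $a_\beta=\frac{u_\beta}{u_\beta+2}$, $b_\beta=\frac1{u_\beta+2}$, where $u_\beta>4$ is the unique solution in $(4,\infty)$ of $\beta=\frac{(u_\beta+2)\log u_\beta}{u_\beta-1}$. For each such vector $\boldsymbol{p}$, the corresponding equilibrium pair and two-coordinate distribution are $\mu_{\boldsymbol{p}}(i)=p_i$, $Q_{\boldsymbol{p}}(i,j)=p_j$, $\gamma_{\boldsymbol{p}}(i,j)=p_ip_j$.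 Moreover, if $\Psi(\beta):=\Pi_{\mathrm{top}}^{\mathcal{E}_\beta}(T)$, then $$\Psi(\beta)=\begin{cases}\log3+\frac\beta6,&0\le\beta\le\beta_c,\\[2pt] \log(u_\beta+2)-\frac{u_\beta}{u_\beta+2}\log u_\beta+\frac\beta2\,\frac{u_\beta^2+2}{(u_\beta+2)^2},&\beta>\beta_c,\end{cases}$$ and the one-sided derivatives satisfy $\Psi'(\beta_c-)=\frac16$, $\Psi'(\beta_c+)=\frac14$, so the temperature-driven transition is first order.
   Context: Finite-state conventions. Let $X$ be a finite set with the discrete metric, $T$ a map assigning to each $i\in X$ a nonempty subset $T(i)\subset X$, and $\Gamma_T=\{(i,j):j\in T(i)\}$. $\mathcal{M}(\Gamma_T)$ is the set of probability vectors on $\Gamma_T$, and $\mathcal{E}:\mathcal{M}(\Gamma_T)\to\mathbb{R}$ is continuous. A stationary transition pair $(\mu,Q)$ consists of a stochastic matrix $Q=(Q(i,j))$ with $Q(i,j)=0$ for $j\notin T(i)$ and a probability vector $\mu$ with $\sum_i\mu(i)Q(i,j)=\mu(j)$. Its two-coordinate distribution is $\gamma_{\mu,Q}(i,j)=\mu(i)Q(i,j)$, and $h_\mu(Q)$ is the entropy rate of the stationary Markov chain, $h_\mu(Q)=-\sum_{i,j}\mu(i)Q(i,j)\log Q(i,j)$ ($0\log0=0$; natural logarithms). A nonlinear equilibrium pair is a stationary transition pair maximizing $h_\mu(Q)+\mathcal{E}(\gamma_{\mu,Q})$ among all stationary transition pairs. Kernels agreeing $\mu$-a.e. are identified. The rotation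 set is $\mathcal{R}(\boldsymbol\psi)=\{\int\boldsymbol\psi\,d\gamma_{\mu,Q}:(\mu,Q)\text{ stationary transition pair}\}$. An equilibrium probability vector is the vector $(p_1,p_2,p_3)$, $p_k=\gamma_{\mu,Q}(X\times\{k\})$, of a nonlinear equilibrium pair $(\mu,Q)$. Nonlinear pressure: for a path $\boldsymbol{x}=(x_0,\dots,x_n)$ with $x_{j+1}\in T(x_j)$, let $L_n(\boldsymbol{x})=\frac1n\sum_{j=0}^{n-1}\delta_{(x_j,x_{j+1})}$; then $\Pi_{\mathrm{top}}^{\mathcal{E}}(T)=\lim_{n\to\infty}\frac1n\log\sum_{\boldsymbol{x}}\exp(n\mathcal{E}(L_n(\boldsymbol{x})))$, the sum over all such paths. The critical inverse temperature is the value of $\beta$ at which the set of equilibrium pairs changes from a single pair to several. *)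

theory Defs
  imports "HOL-Analysis.Analysis"
begin

section \<open>Stationary transition pairs on a finite state space\<close>

text \<open>The state space is a finite type \<open>'n\<close>; vectors and matrices over it are \<open>real ^ 'n\<close> and
  \<open>real ^ 'n ^ 'n\<close>, with \<open>Q $ i $ j\<close> the probability of moving from \<open>i\<close> to \<open>j\<close>.\<close>

definition transition_graph :: "('n \<Rightarrow> 'n set) \<Rightarrow> ('n \<times> 'n) set" where
  "transition_graph T = {(i, j). j \<in> T i}"

definition prob_vector :: "real ^ 'n::finite \<Rightarrow> bool" where
  "prob_vector p \<longleftrightarrow> (\<forall>i. 0 \<le> p $ i) \<and> (\<Sum>i\<in>UNIV. p $ i) = 1"

definition stochastic_matrix :: "real ^ 'n ^ 'n::finite \<Rightarrow> bool" where
  "stochastic_matrix Q \<longleftrightarrow> (\<forall>i. prob_vector (Q $ i))"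

definition stationary_pairs ::
    "('n \<Rightarrow> 'n set) \<Rightarrow> ((real ^ 'n::finite) \<times> (real ^ 'n ^ 'n)) set" where
  "stationary_pairs T = {(\<mu>, Q).
     stochastic_matrix Q \<and> (\<forall>i j. j \<notin> T i \<longrightarrow> Q $ i $ j = 0) \<and>
     prob_vector \<mu> \<and> (\<forall>j. (\<Sum>i\<in>UNIV. \<mu> $ i * Q $ i $ j) = \<mu> $ j)}"

definition two_coordinate ::
    "real ^ 'n::finite \<Rightarrow> real ^ 'n ^ 'n \<Rightarrow> real ^ ('n \<times> 'n)" where
  "two_coordinate \<mu> Q = (\<chi> e. \<mu> $ fst e * Q $ fst e $ snd e)"

text \<open>The convention \<open>0 log 0 = 0\<close> holds because of the factor \<open>Q $ i $ j\<close>.\<close>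

definition entropy_rate :: "real ^ 'n::finite \<Rightarrow> real ^ 'n ^ 'n \<Rightarrow> real" where
  "entropy_rate \<mu> Q = - (\<Sum>i\<in>UNIV. \<Sum>j\<in>UNIV. \<mu> $ i * Q $ i $ j * ln (Q $ i $ j))"

text \<open>An energy is a function on \<open>real ^ ('n \<times> 'n)\<close>; only its values at probability vectors
  supported on \<open>transition_graph T\<close> are ever used.\<close>

definition equilibrium_pairs ::
    "('n \<Rightarrow> 'n set) \<Rightarrow> (real ^ ('n \<times> 'n) \<Rightarrow> real) \<Rightarrow>
     ((real ^ 'n::finite) \<times> (real ^ 'n ^ 'n)) set" where
  "equilibrium_pairs T E = {(\<mu>, Q). (\<mu>, Q) \<in> stationary_pairs T \<and>
     (\<forall>(\<mu>', Q') \<in> stationary_pairs T.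
        entropy_rate \<mu>' Q' + E (two_coordinate \<mu>' Q')
          \<le> entropy_rate \<mu> Q + E (two_coordinate \<mu> Q))}"

text \<open>Identification of kernels that agree almost everywhere with respect to \<open>\<mu>\<close>.\<close>

definition ae_equal ::
    "(((real ^ 'n::finite) \<times> (real ^ 'n ^ 'n)) \<times> ((real ^ 'n) \<times> (real ^ 'n ^ 'n))) set" where
  "ae_equal = {((\<mu>, Q), (\<mu>', Q')). \<mu> = \<mu>' \<and> (\<forall>i. \<mu> $ i \<noteq> 0 \<longrightarrow> Q $ i = Q' $ i)}"

definition rotation_set ::
    "('n::finite \<Rightarrow> 'n set) \<Rightarrow> ('n \<times> 'n \<Rightarrow> 'v::real_vector) \<Rightarrow> 'v set" where
  "rotation_set T \<psi> =
     {\<Sum>e\<in>transition_graph T. (two_coordinate \<mu> Q $ e) *\<^sub>R \<psi> e | \<mu> Q. (\<mu>, Q) \<in> stationary_pairs T}"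

definition second_marginal :: "real ^ ('n \<times> 'n) \<Rightarrow> real ^ 'n::finite" where
  "second_marginal \<gamma> = (\<chi> k. \<Sum>i\<in>UNIV. \<gamma> $ (i, k))"

definition equilibrium_vectors ::
    "('n \<Rightarrow> 'n set) \<Rightarrow> (real ^ ('n \<times> 'n) \<Rightarrow> real) \<Rightarrow> (real ^ 'n::finite) set" where
  "equilibrium_vectors T E =
     {second_marginal (two_coordinate \<mu> Q) | \<mu> Q. (\<mu>, Q) \<in> equilibrium_pairs T E}"

text \<open>For a family of energies indexed by \<open>\<beta> \<ge> 0\<close>; a number with this property is unique.\<close>

definition critical_inverse_temperature ::
    "('n \<Rightarrow> 'n set) \<Rightarrow> (real \<Rightarrow> real ^ ('n::finite \<times> 'n) \<Rightarrow> real) \<Rightarrow> real \<Rightarrow> bool" where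
  "critical_inverse_temperature T E b \<longleftrightarrow> 0 < b \<and>
     (\<forall>\<beta>. 0 \<le> \<beta> \<and> \<beta> < b \<longrightarrow> is_singleton (equilibrium_pairs T (E \<beta>) // ae_equal)) \<and>
     (\<forall>\<beta>. b < \<beta> \<longrightarrow> (\<exists>c \<in> equilibrium_pairs T (E \<beta>) // ae_equal.
                        \<exists>c' \<in> equilibrium_pairs T (E \<beta>) // ae_equal. c \<noteq> c'))"


section \<open>Nonlinear pressure\<close>

definition paths :: "('n \<Rightarrow> 'n set) \<Rightarrow> nat \<Rightarrow> 'n list set" where
  "paths T n = {x. length x = Suc n \<and> (\<forall>j<n. x ! Suc j \<in> T (x ! j))}"

text \<open>The unit vector \<open>axis e 1\<close> is the point mass at \<open>e\<close>.\<close>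

definition empirical :: "nat \<Rightarrow> 'n list \<Rightarrow> real ^ ('n::finite \<times> 'n)" where
  "empirical n x = (1 / real n) *\<^sub>R (\<Sum>j<n. axis (x ! j, x ! Suc j) 1)"

definition pressure_seq ::
    "('n \<Rightarrow> 'n set) \<Rightarrow> (real ^ ('n::finite \<times> 'n) \<Rightarrow> real) \<Rightarrow> nat \<Rightarrow> real" where
  "pressure_seq T E n =
     (1 / real n) * ln (\<Sum>x\<in>paths T n. exp (real n * E (empirical n x)))"

text \<open>Meaningful only when \<open>pressure_seq T E\<close> converges.\<close>

definition nonlinear_pressure ::
    "('n \<Rightarrow> 'n set) \<Rightarrow> (real ^ ('n::finite \<times> 'n) \<Rightarrow> real) \<Rightarrow> real" where
  "nonlinear_pressure T E = lim (pressure_seq T E)"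

text \<open>A first-order transition is a jump of the first derivative of the pressure.\<close>

definition first_order_transition :: "(real \<Rightarrow> real) \<Rightarrow> real \<Rightarrow> bool" where
  "first_order_transition \<Psi> b \<longleftrightarrow>
     (\<exists>l r. (\<Psi> has_real_derivative l) (at_left b) \<and>
            (\<Psi> has_real_derivative r) (at_right b) \<and> l \<noteq> r)"


section \<open>The three-state mean-field Potts example\<close>

text \<open>The state space \<open>{1, 2, 3}\<close> is the type \<open>3\<close>, where the numeral \<open>3\<close> denotes the same element
  as \<open>0\<close> and \<open>UNIV = {1, 2, 3}\<close>.\<close>

definition full_T :: "3 \<Rightarrow> 3 set" where
  "full_T i = UNIV"

definition potts_psi :: "3 \<times> 3 \<Rightarrow> real \<times> real" where
  "potts_psi = (\<lambda>(i, j). (indicator {1} j, indicator {2} j))"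

definition potts_energy :: "real \<Rightarrow> real ^ (3 \<times> 3) \<Rightarrow> real" where
  "potts_energy \<beta> \<gamma> = \<beta> / 2 * (\<Sum>k\<in>UNIV. (second_marginal \<gamma> $ k)\<^sup>2)"

definition potts_u :: "real \<Rightarrow> real" where
  "potts_u \<beta> = (THE u. 4 < u \<and> \<beta> = (u + 2) * ln u / (u - 1))"

definition vec_perms :: "real ^ 'n::finite \<Rightarrow> (real ^ 'n) set" where
  "vec_perms p = {\<chi> i. p $ \<pi> i | \<pi>. \<pi> permutes UNIV}"

definition product_kernel :: "real ^ 'n::finite \<Rightarrow> real ^ 'n ^ 'n" where
  "product_kernel p = (\<chi> i j. p $ j)"

end

theory Submission
  imports Defs "HOL-Real_Asymp.Real_Asymp"
begin

text \<open>The problem first reduces to probability vectors. By Gibbs' inequality the entropy rate of a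
  stationary pair \<open>(\<mu>, Q)\<close> is at most the Shannon entropy \<open>H(\<mu>)\<close>, with equality only if
  \<open>Q(i, \<cdot>) = \<mu>\<close> for \<open>\<mu>\<close>-almost every \<open>i\<close>; and the energy depends on the second marginal alone, which
  is \<open>\<mu>\<close> by stationarity. Hence the equilibrium vectors are the maximizers over the simplex of
  \<open>F\<^sub>\<beta>(p) = H(p) + \<beta>/2 \<Sum> p\<^sub>k\<^sup>2\<close> (lemmas \<open>equilibrium_pairs_potts\<close>, \<open>equilibrium_vectors_potts\<close>).

  A maximizer exists by compactness. Moving mass between two coordinates shows that all
  coordinates are positive, that \<open>ln p\<^sub>k - \<beta> p\<^sub>k\<close> does not depend on \<open>k\<close>, and that
  \<open>2\<beta> \<le> 1/p\<^sub>i + 1/p\<^sub>j\<close> for \<open>i \<noteq> j\<close>. A coordinate above the minimum satisfies \<open>\<beta> p\<^sub>i > 1\<close> by the mean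
  value theorem, so at most one coordinate exceeds the minimum. A maximizer is therefore uniform
  or a permutation of \<open>(u, 1, 1)/(u + 2)\<close> with \<open>u > 1\<close>, and then criticality reads
  \<open>\<beta> = B(u) = (u + 2) ln u / (u - 1)\<close> (lemma \<open>maximizer_is_peak\<close>).

  Along the critical curve \<open>\<beta> = B(u)\<close> the value at the peak minus the value at the uniform vector is
  \<open>D(u) = ln ((u + 2)/3) - (2u + 1)/(3(u + 2)) ln u\<close>. The derivatives of \<open>B\<close> and of \<open>D\<close> are positive
  multiples of one function, which decreases on \<open>(1, 2]\<close> from the value \<open>0\<close>, then increases, and is
  positive from \<open>4\<close> on. It follows that \<open>D < 0\<close> on \<open>(1, 4)\<close>, \<open>D(4) = 0\<close>, \<open>D > 0\<close> on \<open>(4, \<infinity>)\<close>, and that \<open>B\<close>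
  increases on \<open>[4, \<infinity>)\<close> from \<open>B(4) = 4 ln 2\<close> to infinity. This gives the three regimes.

  The pressure is \<open>max F\<^sub>\<beta>\<close> (lemma \<open>pressure_seq_potts\<close>). No counting of types by multinomial
  coefficients is needed: replacing \<open>\<beta>/2 |q|\<^sup>2\<close> by its tangent \<open>\<beta> v\<cdot>q - \<beta>/2 |v|\<^sup>2\<close> at \<open>v\<close> turns the sum over
  paths into a power, of exponential rate \<open>G\<^sub>\<beta>(v) = ln \<Sum> exp (\<beta> v\<^sub>k) - \<beta>/2 |v|\<^sup>2\<close>. The tangent at a maximizer
  bounds the partition function from below; the sum of the tangents at the at most \<open>(n + 1)\<^sup>3\<close>
  attainable frequency vectors bounds it from above; and \<open>G\<^sub>\<beta>\<close> and \<open>F\<^sub>\<beta>\<close> have the same maximum.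
  Finally \<open>F\<^sub>\<beta>(p)\<close> is affine in \<open>\<beta>\<close>, so comparing the maximizers at \<open>\<beta>\<close> and at \<open>4 ln 2\<close> squeezes the
  right difference quotient of the pressure.\<close>

section \<open>Entropy and the reduction to probability vectors\<close>

text \<open>Shannon entropy. The convention \<open>0 log 0 = 0\<close> holds because of the factor \<open>p $ i\<close>.\<close>

definition shannon :: "real ^ 'n::finite \<Rightarrow> real" where
  "shannon p = - (\<Sum>i\<in>UNIV. p $ i * ln (p $ i))"

text \<open>The functional \<open>F\<^sub>\<beta>\<close>: the value at \<open>p\<close> of the variational problem restricted to independent sequences.\<close>

definition mean_field :: "real \<Rightarrow> real ^ 'n::finite \<Rightarrow> real" where
  "mean_field \<beta> p = shannon p + \<beta> / 2 * (\<Sum>i\<in>UNIV. (p $ i)\<^sup>2)"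

text \<open>The maximizers of \<open>F\<^sub>\<beta>\<close> over the probability simplex.\<close>

definition mean_field_maximizers :: "real \<Rightarrow> (real ^ 'n::finite) set" where
  "mean_field_maximizers \<beta> =
     {p. prob_vector p \<and> (\<forall>q :: real ^ 'n. prob_vector q \<longrightarrow> mean_field \<beta> q \<le> mean_field \<beta> p)}"

lemma prob_vectorD:
  assumes "prob_vector p"
  shows "0 \<le> p $ i" "(\<Sum>i\<in>UNIV. p $ i) = 1"
  using assms by (auto simp: prob_vector_def)

text \<open>The summand of a relative entropy, corrected by \<open>m - q\<close> so as to be nonnegative term by term. The
  correction sums to zero over probability vectors. The boundary case \<open>q = m = 0\<close> is allowed.\<close>

lemma gibbs_term:
  fixes q m :: real
  assumes "0 \<le> q" "0 \<le> m" "m = 0 \<Longrightarrow> q = 0"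
  shows "0 \<le> q * ln q - q * ln m + (m - q)"
    and "q * ln q - q * ln m + (m - q) = 0 \<Longrightarrow> q = m"
proof -
  have "0 \<le> q * ln q - q * ln m + (m - q) \<and> (q * ln q - q * ln m + (m - q) = 0 \<longrightarrow> q = m)"
  proof (cases "q = 0")
    case True
    then show ?thesis using assms by auto
  next
    case False
    then have pos: "0 < q" "0 < m" using assms by force+
    have eq: "q * ln q - q * ln m + (m - q) = q * (m / q - 1 - ln (m / q))"
      using pos by (simp add: ln_div field_simps)
    have "0 \<le> m / q - 1 - ln (m / q)"
      using ln_le_minus_one[of "m / q"] pos by simp
    moreover have "q = m" if "m / q - 1 - ln (m / q) = 0"
      using ln_eq_minus_one[of "m / q"] that pos by simp
    ultimately show ?thesis unfolding eq using pos by auto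
  qed
  then show "0 \<le> q * ln q - q * ln m + (m - q)"
    and "q * ln q - q * ln m + (m - q) = 0 \<Longrightarrow> q = m" by auto
qed

lemma gibbs_inequality:
  assumes "prob_vector p" "prob_vector w" "\<And>i. 0 < w $ i"
  shows "shannon p \<le> - (\<Sum>i\<in>UNIV. p $ i * ln (w $ i))"
proof -
  have "0 \<le> (\<Sum>i\<in>UNIV. p $ i * ln (p $ i) - p $ i * ln (w $ i) + (w $ i - p $ i))"
  proof (rule sum_nonneg, rule gibbs_term(1))
    fix i
    show "0 \<le> p $ i" "0 \<le> w $ i" by (simp_all add: prob_vectorD assms)
    show "w $ i = 0 \<Longrightarrow> p $ i = 0" using assms(3)[of i] by simp
  qed
  then show ?thesis
    by (simp add: shannon_def sum.distrib sum_subtractf prob_vectorD[OF assms(1)] prob_vectorD[OF assms(2)])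
qed

lemma stationary_pairsD:
  assumes "(\<mu>, Q) \<in> stationary_pairs T"
  shows "prob_vector \<mu>" "prob_vector (Q $ i)" "(\<Sum>i\<in>UNIV. \<mu> $ i * Q $ i $ j) = \<mu> $ j"
  using assms by (auto simp: stationary_pairs_def stochastic_matrix_def)

lemma second_marginal_two_coordinate:
  assumes "(\<mu>, Q) \<in> stationary_pairs T"
  shows "second_marginal (two_coordinate \<mu> Q) = \<mu>"
  by (simp add: second_marginal_def two_coordinate_def stationary_pairsD[OF assms] vec_eq_iff)

lemma product_kernel_stationary:
  assumes "prob_vector p"
  shows "(p, product_kernel p) \<in> stationary_pairs (\<lambda>_. UNIV)"
  using assms by (simp add: stationary_pairs_def stochastic_matrix_def product_kernel_def
      prob_vector_def flip: sum_distrib_right)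

lemma entropy_rate_product_kernel:
  assumes "prob_vector p"
  shows "entropy_rate p (product_kernel p) = shannon p"
  using prob_vectorD[OF assms]
  by (simp add: entropy_rate_def product_kernel_def shannon_def mult.assoc
      flip: sum_distrib_left sum_distrib_right)

text \<open>The loss of entropy caused by dependence is an average of relative entropies of the rows of \<open>Q\<close>
  with respect to \<open>\<mu>\<close>; the added terms \<open>\<mu> $ j - Q $ i $ j\<close> cancel in the double sum.\<close>

lemma entropy_deficit:
  assumes "(\<mu>, Q) \<in> stationary_pairs T"
  shows "shannon \<mu> - entropy_rate \<mu> Q =
    (\<Sum>i\<in>UNIV. \<Sum>j\<in>UNIV. \<mu> $ i *
       (Q $ i $ j * ln (Q $ i $ j) - Q $ i $ j * ln (\<mu> $ j) + (\<mu> $ j - Q $ i $ j)))"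
proof -
  note S = stationary_pairsD[OF assms]
  have a: "(\<Sum>i\<in>UNIV. \<Sum>j\<in>UNIV. \<mu> $ i * (Q $ i $ j * ln (\<mu> $ j))) = - shannon \<mu>"
    by (subst sum.swap) (simp add: S(3) shannon_def flip: mult.assoc sum_distrib_right)
  have b: "(\<Sum>i\<in>UNIV. \<Sum>j\<in>UNIV. \<mu> $ i * \<mu> $ j) = 1"
    by (simp add: prob_vectorD[OF S(1)] flip: sum_distrib_left)
  have c: "(\<Sum>i\<in>UNIV. \<Sum>j\<in>UNIV. \<mu> $ i * Q $ i $ j) = 1"
    by (simp add: prob_vectorD[OF S(1)] prob_vectorD[OF S(2)] flip: sum_distrib_left)
  show ?thesis
    using a b c
    by (simp add: algebra_simps sum.distrib sum_subtractf entropy_rate_def)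
qed

lemma entropy_deficit_term:
  assumes "(\<mu>, Q) \<in> stationary_pairs T"
  shows "0 \<le> \<mu> $ i * (Q $ i $ j * ln (Q $ i $ j) - Q $ i $ j * ln (\<mu> $ j) + (\<mu> $ j - Q $ i $ j))"
    and "\<mu> $ i * (Q $ i $ j * ln (Q $ i $ j) - Q $ i $ j * ln (\<mu> $ j) + (\<mu> $ j - Q $ i $ j)) = 0
      \<Longrightarrow> \<mu> $ i \<noteq> 0 \<Longrightarrow> Q $ i $ j = \<mu> $ j"
proof -
  note S = stationary_pairsD[OF assms]
  have q: "0 \<le> Q $ i $ j" and m: "0 \<le> \<mu> $ j" "0 \<le> \<mu> $ i"
    by (simp_all add: prob_vectorD[OF S(1)] prob_vectorD[OF S(2)])
  \<comment> \<open>stationarity: a state of mass zero is not reached from a state of positive mass\<close>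
  have null: "Q $ i $ j = 0" if "\<mu> $ i \<noteq> 0" "\<mu> $ j = 0"
  proof -
    have "\<mu> $ i * Q $ i $ j = 0"
      using S(3)[of j] that(2) prob_vectorD(1)[OF S(1)] prob_vectorD(1)[OF S(2)]
      by (simp add: sum_nonneg_eq_0_iff)
    with that show ?thesis by simp
  qed
  show "0 \<le> \<mu> $ i * (Q $ i $ j * ln (Q $ i $ j) - Q $ i $ j * ln (\<mu> $ j) + (\<mu> $ j - Q $ i $ j))"
    using gibbs_term(1)[OF q m(1)] null m(2) by (cases "\<mu> $ i = 0") auto
  show "\<mu> $ i * (Q $ i $ j * ln (Q $ i $ j) - Q $ i $ j * ln (\<mu> $ j) + (\<mu> $ j - Q $ i $ j)) = 0
      \<Longrightarrow> \<mu> $ i \<noteq> 0 \<Longrightarrow> Q $ i $ j = \<mu> $ j"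
    using gibbs_term(2)[OF q m(1)] null by auto
qed

lemma entropy_rate_le_shannon:
  assumes "(\<mu>, Q) \<in> stationary_pairs T"
  shows "entropy_rate \<mu> Q \<le> shannon \<mu>"
proof -
  have "0 \<le> shannon \<mu> - entropy_rate \<mu> Q"
    unfolding entropy_deficit[OF assms] by (intro sum_nonneg entropy_deficit_term(1)[OF assms])
  then show ?thesis by simp
qed

lemma entropy_rate_eq_shannonD:
  assumes st: "(\<mu>, Q) \<in> stationary_pairs T" and eq: "entropy_rate \<mu> Q = shannon \<mu>"
  shows "((\<mu>, Q), (\<mu>, product_kernel \<mu>)) \<in> ae_equal"
proof -
  let ?d = "\<lambda>i j. \<mu> $ i *
    (Q $ i $ j * ln (Q $ i $ j) - Q $ i $ j * ln (\<mu> $ j) + (\<mu> $ j - Q $ i $ j))"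
  have "(\<Sum>i\<in>UNIV. \<Sum>j\<in>UNIV. ?d i j) = 0"
    using entropy_deficit[OF st] eq by simp
  then have d0: "?d i j = 0" for i j
    using entropy_deficit_term(1)[OF st] by (simp add: sum_nonneg_eq_0_iff sum_nonneg) blast
  have "Q $ i $ j = \<mu> $ j" if "\<mu> $ i \<noteq> 0" for i j
    using entropy_deficit_term(2)[OF st d0 that] .
  then show ?thesis
    by (simp add: ae_equal_def product_kernel_def vec_eq_iff)
qed

lemma entropy_rate_ae_equal:
  assumes "((\<mu>, Q), (\<mu>', Q')) \<in> ae_equal"
  shows "entropy_rate \<mu> Q = entropy_rate \<mu>' Q'"
proof -
  have "\<mu> $ i * Q $ i $ j * ln (Q $ i $ j) = \<mu>' $ i * Q' $ i $ j * ln (Q' $ i $ j)" for i j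
    using assms by (cases "\<mu> $ i = 0") (auto simp: ae_equal_def)
  then show ?thesis by (simp add: entropy_rate_def)
qed

section \<open>Equilibrium pairs\<close>

lemma full_T_eq: "full_T = (\<lambda>_. UNIV)"
  by (simp add: fun_eq_iff full_T_def)

lemma potts_objective:
  assumes "(\<mu>, Q) \<in> stationary_pairs full_T"
  shows "entropy_rate \<mu> Q + potts_energy \<beta> (two_coordinate \<mu> Q)
    = mean_field \<beta> \<mu> - (shannon \<mu> - entropy_rate \<mu> Q)"
  by (simp add: potts_energy_def second_marginal_two_coordinate[OF assms] mean_field_def)

text \<open>The equilibrium pairs are the independent ones whose one-coordinate distribution maximizes \<open>F\<^sub>\<beta>\<close>.\<close>

lemma equilibrium_pairs_potts:
  "(\<mu>, Q) \<in> equilibrium_pairs full_T (potts_energy \<beta>) \<longleftrightarrow>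
     (\<mu>, Q) \<in> stationary_pairs full_T \<and> \<mu> \<in> mean_field_maximizers \<beta> \<and>
     ((\<mu>, Q), (\<mu>, product_kernel \<mu>)) \<in> ae_equal"
    (is "?L \<longleftrightarrow> ?R")
proof
  assume L: ?L
  then have st: "(\<mu>, Q) \<in> stationary_pairs full_T" by (simp add: equilibrium_pairs_def)
  note \<mu> = stationary_pairsD(1)[OF st]
  have max: "mean_field \<beta> p \<le> mean_field \<beta> \<mu> - (shannon \<mu> - entropy_rate \<mu> Q)"
    if "prob_vector p" for p :: "real ^ 3"
  proof -
    have st': "(p, product_kernel p) \<in> stationary_pairs full_T"
      using product_kernel_stationary[OF that] by (simp add: full_T_eq)
    have "entropy_rate p (product_kernel p) + potts_energy \<beta> (two_coordinate p (product_kernel p))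
      \<le> entropy_rate \<mu> Q + potts_energy \<beta> (two_coordinate \<mu> Q)"
      using L st' unfolding equilibrium_pairs_def by auto
    then show ?thesis
      using potts_objective[OF st, of \<beta>] potts_objective[OF st', of \<beta>] entropy_rate_product_kernel[OF that]
      by linarith
  qed
  have "entropy_rate \<mu> Q = shannon \<mu>"
    using max[OF \<mu>] entropy_rate_le_shannon[OF st] by simp
  then show ?R
    using st max \<mu> entropy_rate_eq_shannonD[OF st] by (simp add: mean_field_maximizers_def)
next
  assume R: ?R
  then have st: "(\<mu>, Q) \<in> stationary_pairs full_T" by simp
  note \<mu> = stationary_pairsD(1)[OF st]
  have eq: "entropy_rate \<mu> Q = shannon \<mu>"
    using R entropy_rate_ae_equal entropy_rate_product_kernel[OF \<mu>] by metis
  have "entropy_rate \<mu>' Q' + potts_energy \<beta> (two_coordinate \<mu>' Q')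
      \<le> entropy_rate \<mu> Q + potts_energy \<beta> (two_coordinate \<mu> Q)"
    if st': "(\<mu>', Q') \<in> stationary_pairs full_T" for \<mu>' Q'
  proof -
    have "mean_field \<beta> \<mu>' \<le> mean_field \<beta> \<mu>"
      using R stationary_pairsD(1)[OF st'] by (simp add: mean_field_maximizers_def)
    then show ?thesis
      using potts_objective[OF st, of \<beta>] potts_objective[OF st', of \<beta>] eq
        entropy_rate_le_shannon[OF st'] by linarith
  qed
  then show ?L using st by (auto simp: equilibrium_pairs_def)
qed

lemma product_pair_in_equilibrium:
  assumes "p \<in> mean_field_maximizers \<beta>"
  shows "(p, product_kernel p) \<in> equilibrium_pairs full_T (potts_energy \<beta>)"
  using assms product_kernel_stationary[of p]
  by (simp add: equilibrium_pairs_potts mean_field_maximizers_def ae_equal_def full_T_eq[symmetric])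

lemma equilibrium_vectors_potts:
  "equilibrium_vectors full_T (potts_energy \<beta>) = mean_field_maximizers \<beta>"
proof (intro set_eqI iffI)
  fix p assume "p \<in> equilibrium_vectors full_T (potts_energy \<beta>)"
  then show "p \<in> mean_field_maximizers \<beta>"
    by (auto simp: equilibrium_vectors_def equilibrium_pairs_potts second_marginal_two_coordinate)
next
  fix p :: "real ^ 3" assume p: "p \<in> mean_field_maximizers \<beta>"
  have "(p, product_kernel p) \<in> equilibrium_pairs full_T (potts_energy \<beta>)"
    by (rule product_pair_in_equilibrium[OF p])
  moreover from this have "second_marginal (two_coordinate p (product_kernel p)) = p"
    by (auto simp: equilibrium_pairs_potts intro: second_marginal_two_coordinate)
  ultimately show "p \<in> equilibrium_vectors full_T (potts_energy \<beta>)"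
    unfolding equilibrium_vectors_def by force
qed

lemma equiv_ae_equal: "equiv UNIV ae_equal"
  by (auto simp: equiv_def refl_on_def sym_def trans_def ae_equal_def)

lemma equilibrium_classes:
  "equilibrium_pairs full_T (potts_energy \<beta>) // ae_equal
    = (\<lambda>p. ae_equal `` {(p, product_kernel p)}) ` mean_field_maximizers \<beta>"
proof (intro set_eqI iffI)
  fix c :: "((real ^ 3) \<times> (real ^ 3 ^ 3)) set"
  assume "c \<in> equilibrium_pairs full_T (potts_energy \<beta>) // ae_equal"
  then obtain \<mu> Q where "(\<mu>, Q) \<in> equilibrium_pairs full_T (potts_energy \<beta>)"
    and c: "c = ae_equal `` {(\<mu>, Q)}" by (auto elim!: quotientE)
  then have \<mu>: "\<mu> \<in> mean_field_maximizers \<beta>"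
    and ae: "((\<mu>, Q), (\<mu>, product_kernel \<mu>)) \<in> ae_equal"
    by (auto simp: equilibrium_pairs_potts)
  have "c = ae_equal `` {(\<mu>, product_kernel \<mu>)}"
    unfolding c by (rule equiv_class_eq[OF equiv_ae_equal ae])
  with \<mu> show "c \<in> (\<lambda>p. ae_equal `` {(p, product_kernel p)}) ` mean_field_maximizers \<beta>" by blast
next
  fix c :: "((real ^ 3) \<times> (real ^ 3 ^ 3)) set"
  assume "c \<in> (\<lambda>p. ae_equal `` {(p, product_kernel p)}) ` mean_field_maximizers \<beta>"
  then show "c \<in> equilibrium_pairs full_T (potts_energy \<beta>) // ae_equal"
    by (auto intro: quotientI product_pair_in_equilibrium)
qed

lemma inj_product_kernel_class: "inj (\<lambda>p. ae_equal `` {(p, product_kernel p)})"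
proof (rule injI)
  fix p q :: "real ^ 'n"
  assume "ae_equal `` {(p, product_kernel p)} = ae_equal `` {(q, product_kernel q)}"
  then have "((p, product_kernel p), (q, product_kernel q)) \<in> ae_equal"
    by (rule eq_equiv_class[OF _ equiv_ae_equal]) simp
  then show "p = q" by (simp add: ae_equal_def)
qed

lemma rotation_set_potts:
  "rotation_set full_T potts_psi = {(p1, p2). 0 \<le> p1 \<and> 0 \<le> p2 \<and> p1 + p2 \<le> 1}"
proof -
  have val: "(\<Sum>e\<in>transition_graph full_T. (two_coordinate \<mu> Q $ e) *\<^sub>R potts_psi e) = (\<mu> $ 1, \<mu> $ 2)"
    if st: "(\<mu>, Q) \<in> stationary_pairs full_T" for \<mu> Q
  proof -
    have "(\<Sum>e\<in>transition_graph full_T. (two_coordinate \<mu> Q $ e) *\<^sub>R potts_psi e)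
      = (\<Sum>i\<in>UNIV. \<Sum>j\<in>UNIV. (\<mu> $ i * Q $ i $ j) *\<^sub>R potts_psi (i, j))"
      by (simp add: transition_graph_def full_T_def two_coordinate_def sum.cartesian_product split_def)
    also have "\<dots> = (\<Sum>j\<in>UNIV. \<mu> $ j *\<^sub>R ((indicator {1} j, indicator {2} j) :: real \<times> real))"
      by (subst sum.swap) (simp add: potts_psi_def stationary_pairsD(3)[OF st] del: scaleR_Pair flip: scaleR_sum_left)
    also have "\<dots> = (\<mu> $ 1, \<mu> $ 2)"
      by (simp add: sum_3 potts_psi_def)
    finally show ?thesis .
  qed
  show ?thesis
  proof (intro set_eqI iffI)
    fix x assume "x \<in> rotation_set full_T potts_psi"
    then obtain \<mu> Q where st: "(\<mu>, Q) \<in> stationary_pairs full_T" and x: "x = (\<mu> $ 1, \<mu> $ 2)"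
      by (auto simp: rotation_set_def val)
    show "x \<in> {(p1, p2). 0 \<le> p1 \<and> 0 \<le> p2 \<and> p1 + p2 \<le> 1}"
      using stationary_pairsD(1)[OF st] by (auto simp: x prob_vector_def forall_3 sum_3)
  next
    fix x :: "real \<times> real" assume "x \<in> {(p1, p2). 0 \<le> p1 \<and> 0 \<le> p2 \<and> p1 + p2 \<le> 1}"
    then obtain a b where x: "x = (a, b)" and ab: "0 \<le> a" "0 \<le> b" "a + b \<le> 1" by auto
    define p :: "real ^ 3" where "p = vector [a, b, 1 - a - b]"
    have "prob_vector p" using ab by (simp add: prob_vector_def p_def forall_3 sum_3 vector_3)
    then have st: "(p, product_kernel p) \<in> stationary_pairs full_T"
      using product_kernel_stationary by (simp add: full_T_eq)
    have "x = (p $ 1, p $ 2)" by (simp add: x p_def vector_3)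
    then show "x \<in> rotation_set full_T potts_psi"
      using val[OF st] st unfolding rotation_set_def by force
  qed
qed

section \<open>One-variable analysis\<close>

text \<open>The inverse temperature at which \<open>(u, 1, 1)/(u + 2)\<close> is a critical point of \<open>F\<^sub>\<beta>\<close>.\<close>

definition potts_beta :: "real \<Rightarrow> real" where
  "potts_beta u = (u + 2) * ln u / (u - 1)"

text \<open>The value of \<open>F\<^sub>\<beta>\<close> at \<open>(u, 1, 1)/(u + 2)\<close> minus its value at the uniform vector, for
  \<open>\<beta> = potts_beta u\<close> and \<open>u > 1\<close>; see \<open>mean_field_peak_gap\<close>.\<close>

definition potts_gap :: "real \<Rightarrow> real" where
  "potts_gap u = ln ((u + 2) / 3) - (2 * u + 1) / (3 * (u + 2)) * ln u"

text \<open>The common sign of the derivatives of \<open>potts_beta\<close> and \<open>potts_gap\<close> on \<open>(1, \<infinity>)\<close>.\<close>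

definition slope_sign :: "real \<Rightarrow> real" where
  "slope_sign u = (u + 1 - 2 / u) / 3 - ln u"

lemma slope_sign_deriv:
  assumes "0 < u"
  shows "(slope_sign has_real_derivative (u - 1) * (u - 2) / (3 * u\<^sup>2)) (at u)"
  unfolding slope_sign_def
  using assms by (auto intro!: derivative_eq_intros simp: field_simps power2_eq_square)

lemma potts_gap_deriv:
  assumes "0 < u"
  shows "(potts_gap has_real_derivative slope_sign u / (u + 2)\<^sup>2) (at u)"
  unfolding potts_gap_def slope_sign_def
  by (rule derivative_eq_intros refl | (use assms in \<open>simp; fail\<close>))+
    (use assms in \<open>simp add: divide_simps, simp add: algebra_simps power2_eq_square\<close>)

lemma potts_beta_deriv:
  assumes "1 < u"
  shows "(potts_beta has_real_derivative 3 * slope_sign u / (u - 1)\<^sup>2) (at u)"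
  unfolding potts_beta_def slope_sign_def
  by (rule derivative_eq_intros refl | (use assms in \<open>simp; fail\<close>))+
    (use assms in \<open>simp add: divide_simps, simp add: algebra_simps power2_eq_square\<close>)

lemma slope_sign_neg:
  assumes "1 < u" "u \<le> 2"
  shows "slope_sign u < 0"
proof -
  have "slope_sign u < slope_sign 1"
  proof (rule DERIV_neg_imp_decreasing_open[OF assms(1)])
    fix x assume "1 < x" "x < u"
    then show "\<exists>y. (slope_sign has_real_derivative y) (at x) \<and> y < 0"
      using slope_sign_deriv[of x] assms
      by (intro exI[of _ "(x - 1) * (x - 2) / (3 * x\<^sup>2)"]) (auto simp: divide_simps mult_less_0_iff)
  next
    show "continuous_on {1..u} slope_sign"
      by (rule continuous_at_imp_continuous_on) (auto intro!: DERIV_isCont slope_sign_deriv)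
  qed
  then show ?thesis by (simp add: slope_sign_def)
qed

lemma slope_sign_increasing:
  assumes "2 \<le> u" "u < v"
  shows "slope_sign u < slope_sign v"
proof (rule DERIV_pos_imp_increasing_open[OF assms(2)])
  fix x assume "u < x" "x < v"
  then show "\<exists>y. (slope_sign has_real_derivative y) (at x) \<and> 0 < y"
    using slope_sign_deriv[of x] assms
    by (intro exI[of _ "(x - 1) * (x - 2) / (3 * x\<^sup>2)"]) auto
next
  show "continuous_on {u..v} slope_sign"
    using assms by (intro continuous_at_imp_continuous_on) (auto intro!: DERIV_isCont slope_sign_deriv)
qed

lemma ln_4_eq: "ln 4 = 2 * ln (2::real)"
  using ln_realpow[of 2 2] by simp

lemma slope_sign_pos:
  assumes "4 \<le> u"
  shows "0 < slope_sign u"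
proof -
  have "0 < slope_sign 4"
    using ln2_le_25_over_36 by (simp add: slope_sign_def ln_4_eq)
  also have "\<dots> \<le> slope_sign u"
    using assms slope_sign_increasing[of 4 u] by (cases "u = 4") auto
  finally show ?thesis .
qed

lemma potts_gap_mono:
  assumes "0 < u" "u < v" "\<And>x. u < x \<Longrightarrow> x < v \<Longrightarrow> 0 < slope_sign x"
  shows "potts_gap u < potts_gap v"
proof (rule DERIV_pos_imp_increasing_open[OF assms(2)])
  fix x assume x: "u < x" "x < v"
  then show "\<exists>y. (potts_gap has_real_derivative y) (at x) \<and> 0 < y"
    using potts_gap_deriv[of x] assms(1) assms(3)[OF x]
    by (intro exI[of _ "slope_sign x / (x + 2)\<^sup>2"]) auto
next
  show "continuous_on {u..v} potts_gap"
    using assms by (intro continuous_at_imp_continuous_on) (auto intro!: DERIV_isCont potts_gap_deriv)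
qed

lemma potts_gap_antimono:
  assumes "0 < u" "u < v" "\<And>x. u < x \<Longrightarrow> x < v \<Longrightarrow> slope_sign x < 0"
  shows "potts_gap v < potts_gap u"
proof (rule DERIV_neg_imp_decreasing_open[OF assms(2)])
  fix x assume x: "u < x" "x < v"
  then show "\<exists>y. (potts_gap has_real_derivative y) (at x) \<and> y < 0"
    using potts_gap_deriv[of x] assms(1) assms(3)[OF x]
    by (intro exI[of _ "slope_sign x / (x + 2)\<^sup>2"]) (auto simp: divide_simps)
next
  show "continuous_on {u..v} potts_gap"
    using assms by (intro continuous_at_imp_continuous_on) (auto intro!: DERIV_isCont potts_gap_deriv)
qed

lemma potts_gap_4: "potts_gap 4 = 0"
  by (simp add: potts_gap_def ln_4_eq)

text \<open>As \<open>slope_sign\<close> is negative and then positive on \<open>(1, 4)\<close>, the gap decreases and then increases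
  there, between two zeros.\<close>

lemma potts_gap_neg:
  assumes "1 < u" "u < 4"
  shows "potts_gap u < 0"
proof (cases "slope_sign u \<le> 0")
  case True
  have "potts_gap u < potts_gap 1"
  proof (rule potts_gap_antimono)
    fix x assume x: "1 < x" "x < u"
    show "slope_sign x < 0"
    proof (cases "x \<le> 2")
      case False
      then show ?thesis using slope_sign_increasing[of x u] x True by simp
    qed (use x slope_sign_neg in simp)
  qed (use assms in auto)
  then show ?thesis by (simp add: potts_gap_def)
next
  case False
  then have "2 < u" using slope_sign_neg[of u] assms by force
  have "potts_gap u < potts_gap 4"
    using assms False slope_sign_increasing[of u] \<open>2 < u\<close>
    by (intro potts_gap_mono) force+
  then show ?thesis by (simp add: potts_gap_4)
qed

lemma potts_gap_pos:
  assumes "4 < u"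
  shows "0 < potts_gap u"
  using potts_gap_mono[of 4 u] assms slope_sign_pos potts_gap_4 by simp

lemma potts_beta_4: "potts_beta 4 = 4 * ln 2"
  by (simp add: potts_beta_def ln_4_eq)

lemma isCont_potts_beta: "1 < u \<Longrightarrow> isCont potts_beta u"
  by (rule DERIV_isCont[OF potts_beta_deriv])

lemma potts_beta_strict_mono:
  assumes "4 \<le> u" "u < v"
  shows "potts_beta u < potts_beta v"
proof (rule DERIV_pos_imp_increasing_open[OF assms(2)])
  fix x assume x: "u < x" "x < v"
  then show "\<exists>y. (potts_beta has_real_derivative y) (at x) \<and> 0 < y"
    using potts_beta_deriv[of x] assms slope_sign_pos[of x]
    by (intro exI[of _ "3 * slope_sign x / (x - 1)\<^sup>2"]) auto
next
  show "continuous_on {u..v} potts_beta"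
    using assms by (intro continuous_at_imp_continuous_on) (auto intro!: isCont_potts_beta)
qed

lemma potts_beta_ex1:
  fixes \<beta> :: real
  assumes "4 * ln 2 < \<beta>"
  shows "\<exists>!u. 4 < u \<and> \<beta> = (u + 2) * ln u / (u - 1)"
proof -
  have "filterlim potts_beta at_top at_top" unfolding potts_beta_def by real_asymp
  then have "\<forall>\<^sub>F u in at_top. \<beta> \<le> potts_beta u" by (simp add: filterlim_at_top)
  then obtain v where v: "4 \<le> v" "\<beta> \<le> potts_beta v"
    by (metis eventually_at_top_linorder linorder_linear)
  have "\<exists>u\<ge>4. u \<le> v \<and> potts_beta u = \<beta>"
    using v assms by (intro IVT) (auto simp: potts_beta_4 isCont_potts_beta)
  then obtain u where u: "4 \<le> u" "potts_beta u = \<beta>" by auto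
  have "u \<noteq> 4" using u assms potts_beta_4 by auto
  have "w = u" if "4 < w" "potts_beta w = \<beta>" for w
    using potts_beta_strict_mono[of u w] potts_beta_strict_mono[of w u] u that
    by (cases u w rule: linorder_cases) auto
  with u \<open>u \<noteq> 4\<close> show ?thesis unfolding potts_beta_def by (intro ex1I[of _ u]) auto
qed

lemma potts_u_root:
  assumes "4 * ln 2 < \<beta>"
  shows "4 < potts_u \<beta>" "potts_beta (potts_u \<beta>) = \<beta>"
  using theI'[OF potts_beta_ex1[OF assms]] by (auto simp: potts_u_def potts_beta_def)

lemma potts_u_unique:
  assumes "4 < u"
  shows "potts_u (potts_beta u) = u"
proof -
  have "4 * ln 2 < potts_beta u" using potts_beta_strict_mono[of 4 u] assms potts_beta_4 by simp
  from potts_u_root[OF this] assms show ?thesis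
    using potts_beta_strict_mono[of u "potts_u (potts_beta u)"]
      potts_beta_strict_mono[of "potts_u (potts_beta u)" u] by fastforce
qed

lemma potts_u_tendsto: "(potts_u \<longlongrightarrow> 4) (at_right (4 * ln 2))"
proof (rule order_tendstoI)
  fix a :: real assume "a < 4"
  then show "\<forall>\<^sub>F \<beta> in at_right (4 * ln 2). a < potts_u \<beta>"
    using potts_u_root(1) by (intro eventually_at_right_less[THEN eventually_mono]) force
next
  fix a :: real assume a: "4 < a"
  have "4 * ln 2 < potts_beta a" using potts_beta_strict_mono[of 4 a] a potts_beta_4 by simp
  then have "\<forall>\<^sub>F \<beta> in at_right (4 * ln 2). \<beta> \<in> {4 * ln 2<..<potts_beta a}"
    by (rule eventually_at_rightI[rotated])
  then show "\<forall>\<^sub>F \<beta> in at_right (4 * ln 2). potts_u \<beta> < a"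
  proof (rule eventually_mono)
    fix \<beta> assume b: "\<beta> \<in> {4 * ln 2<..<potts_beta a}"
    then show "potts_u \<beta> < a"
      using potts_u_root[of \<beta>] a potts_beta_strict_mono[of a "potts_u \<beta>"]
      by (cases "potts_u \<beta>" a rule: linorder_cases) auto
  qed
qed

section \<open>Shape of the maximizers\<close>

lemma xlnx_continuous: "continuous_on {0..} (\<lambda>x::real. x * ln x)"
proof -
  have "((\<lambda>x::real. x * ln x) \<longlongrightarrow> 0) (at_right 0)" by real_asymp
  then have "continuous (at 0 within {0..}) (\<lambda>x::real. x * ln x)"
    by (simp add: continuous_within at_within_Ici_at_right)
  moreover have "continuous (at x within {0..}) (\<lambda>x::real. x * ln x)" if "0 < x" for x
    using that by (intro continuous_intros) auto
  ultimately show ?thesis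
    unfolding continuous_on_eq_continuous_within by (metis atLeast_iff le_less)
qed

lemma compact_prob_vectors: "compact {p :: real ^ 'n::finite. prob_vector p}"
proof -
  have le: "p $ i \<le> 1" if "prob_vector p" for p :: "real ^ 'n" and i
    using member_le_sum[of i UNIV "($) p"] prob_vectorD[OF that] by simp
  have "{p :: real ^ 'n. prob_vector p} \<subseteq> cbox 0 1"
    using le by (auto simp: mem_box_cart prob_vectorD)
  then have "bounded {p :: real ^ 'n. prob_vector p}"
    by (rule bounded_subset[OF bounded_cbox])
  moreover have "closed {p :: real ^ 'n. prob_vector p}"
    unfolding prob_vector_def
    by (intro closed_Collect_conj closed_Collect_all closed_Collect_le closed_Collect_eq continuous_intros)
  ultimately show ?thesis by (simp add: compact_eq_bounded_closed)
qed

lemma mean_field_maximizer_exists: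
  "\<exists>p :: real ^ 'n::finite. p \<in> mean_field_maximizers \<beta>"
proof -
  have "prob_vector (\<chi> i::'n. 1 / real CARD('n))" by (simp add: prob_vector_def)
  then have ne: "{p :: real ^ 'n. prob_vector p} \<noteq> {}" by blast
  have comp: "continuous_on {p :: real ^ 'n. prob_vector p} (\<lambda>p. p $ i * ln (p $ i))" for i
    by (rule continuous_on_compose2[OF xlnx_continuous, of _ "\<lambda>p. p $ i"])
      (auto intro!: continuous_intros simp: prob_vectorD)
  have "continuous_on {p :: real ^ 'n. prob_vector p} (mean_field \<beta>)"
    unfolding mean_field_def shannon_def by (intro continuous_intros comp)
  from continuous_attains_sup[OF compact_prob_vectors ne this]
  show ?thesis by (auto simp: mean_field_maximizers_def)
qed

text \<open>The contribution of one coordinate to \<open>F\<^sub>\<beta>\<close>.\<close>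

definition site :: "real \<Rightarrow> real \<Rightarrow> real" where
  "site \<beta> x = \<beta> / 2 * x\<^sup>2 - x * ln x"

lemma mean_field_site: "mean_field \<beta> p = (\<Sum>i\<in>UNIV. site \<beta> (p $ i))"
  by (simp add: mean_field_def shannon_def site_def sum_subtractf sum_distrib_left)

text \<open>Redistributing the mass of two coordinates reduces the optimality conditions to a problem in one
  real variable.\<close>

lemma maximizer_pair:
  fixes p :: "real ^ 'n::finite"
  assumes p: "p \<in> mean_field_maximizers \<beta>" and ij: "i \<noteq> j"
    and xy: "0 \<le> x" "0 \<le> y" "x + y = p $ i + p $ j"
  shows "site \<beta> x + site \<beta> y \<le> site \<beta> (p $ i) + site \<beta> (p $ j)"
proof -
  define q :: "real ^ 'n" where "q = (\<chi> k. if k = i then x else if k = j then y else p $ k)"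
  have pv: "prob_vector p" using p by (simp add: mean_field_maximizers_def)
  have split: "(\<Sum>k\<in>UNIV. f k) = f i + f j + (\<Sum>k\<in>UNIV - {i, j}. f k)" for f :: "'n \<Rightarrow> real"
    using ij by (subst sum.subset_diff[of "{i, j}"]) auto
  have rest: "(\<Sum>k\<in>UNIV - {i, j}. f (q $ k)) = (\<Sum>k\<in>UNIV - {i, j}. f (p $ k))"
    for f :: "real \<Rightarrow> real"
    by (intro sum.cong) (auto simp: q_def)
  have qij: "q $ i = x" "q $ j = y" using ij by (auto simp: q_def)
  have "(\<Sum>k\<in>UNIV. q $ k) = (\<Sum>k\<in>UNIV. p $ k)"
    using rest[of "\<lambda>t. t"] xy by (simp add: split qij)
  moreover have "0 \<le> q $ k" for k
    using xy by (simp add: q_def prob_vectorD[OF pv])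
  ultimately have "prob_vector q" using pv by (simp add: prob_vector_def)
  then have "mean_field \<beta> q \<le> mean_field \<beta> p" using p by (simp add: mean_field_maximizers_def)
  then show ?thesis using rest[of "site \<beta>"] by (simp add: mean_field_site split qij)
qed

text \<open>An empty coordinate is never optimal: the entropy gained from a small mass \<open>t\<close> is of order
  \<open>t ln (1/t)\<close> and beats the linear loss of energy.\<close>

lemma site_spread_improves:
  assumes "0 < b" "0 \<le> \<beta>"
  obtains x y where "0 \<le> x" "0 \<le> y" "x + y = b" "site \<beta> 0 + site \<beta> b < site \<beta> x + site \<beta> y"
proof -
  \<comment> \<open>here the entropy gain \<open>t ln (b/t)\<close> exceeds the loss \<open>\<beta> b t\<close> by exactly \<open>t\<close>\<close>
  define t where "t = b * exp (- \<beta> * b - 1)"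
  have "\<beta> * b \<ge> 0" using assms by simp
  then have "exp (- \<beta> * b - 1) < 1" by simp
  then have t: "0 < t" "t < b" using assms by (auto simp: t_def)
  have lnt: "ln t = ln b - \<beta> * b - 1" using assms by (simp add: t_def ln_mult)
  have "(b - t) * ln (b - t) \<le> (b - t) * ln b" using t by (intro mult_left_mono) auto
  then have "site \<beta> t + site \<beta> (b - t) \<ge> \<beta> / 2 * (t\<^sup>2 + (b - t)\<^sup>2) - t * ln t - (b - t) * ln b"
    by (simp add: site_def algebra_simps)
  also have "\<beta> / 2 * (t\<^sup>2 + (b - t)\<^sup>2) - t * ln t - (b - t) * ln b
    = \<beta> / 2 * b\<^sup>2 - b * ln b + \<beta> * t\<^sup>2 + t"
    by (simp add: lnt power2_eq_square field_simps)
  finally have "site \<beta> t + site \<beta> (b - t) \<ge> site \<beta> 0 + site \<beta> b + \<beta> * t\<^sup>2 + t"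
    by (simp add: site_def)
  moreover have "\<beta> * t\<^sup>2 \<ge> 0" using assms by simp
  ultimately have "site \<beta> 0 + site \<beta> b < site \<beta> t + site \<beta> (b - t)" using t by linarith
  then show thesis using t by (intro that[of t "b - t"]) auto
qed

lemma site_deriv:
  assumes "0 < x"
  shows "(site \<beta> has_real_derivative \<beta> * x - ln x - 1) (at x)"
  unfolding site_def using assms by (auto intro!: derivative_eq_intros)

text \<open>First and second order conditions for the optimal division of \<open>a + b\<close> between two coordinates.\<close>

lemma site_interior:
  assumes a: "0 < a" and b: "0 < b"
    and max: "\<And>x y. 0 \<le> x \<Longrightarrow> 0 \<le> y \<Longrightarrow> x + y = a + b \<Longrightarrow> site \<beta> x + site \<beta> y \<le> site \<beta> a + site \<beta> b"
  shows "ln a - \<beta> * a = ln b - \<beta> * b" and "2 * \<beta> \<le> 1 / a + 1 / b"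
proof -
  define g where "g t = site \<beta> (a + t) + site \<beta> (b - t)" for t
  define g' where "g' t = \<beta> * (a + t) - ln (a + t) - \<beta> * (b - t) + ln (b - t)" for t
  define d where "d = min a b"
  have d: "0 < d" using a b by (simp add: d_def)
  have g_deriv: "(g has_real_derivative g' t) (at t)" if "\<bar>t\<bar> < d" for t
  proof -
    have "0 < a + t" "0 < b - t" using that by (auto simp: d_def)
    then show ?thesis unfolding g_def g'_def
      by (auto intro!: derivative_eq_intros DERIV_chain2[OF site_deriv])
  qed
  have g_max: "g t \<le> g 0" if "\<bar>t\<bar> < d" for t
  proof -
    have "0 \<le> a + t" "0 \<le> b - t" using that by (auto simp: d_def)
    then show ?thesis using max[of "a + t" "b - t"] by (simp add: g_def)
  qed
  have crit: "g' 0 = 0"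
    by (rule DERIV_local_max[of g _ 0 d]) (use g_deriv[of 0] g_max d in auto)
  then show "ln a - \<beta> * a = ln b - \<beta> * b" by (simp add: g'_def)
  have g'_deriv: "(g' has_real_derivative (2 * \<beta> - (1 / a + 1 / b))) (at 0)"
    unfolding g'_def using a b by (auto intro!: derivative_eq_intros simp: field_simps)
  show "2 * \<beta> \<le> 1 / a + 1 / b"
  proof (rule ccontr)
    \<comment> \<open>otherwise \<open>g'\<close> is positive to the right of its zero, and \<open>g\<close> increases there\<close>
    assume "\<not> ?thesis"
    then obtain e where e: "0 < e" "\<And>h. 0 < h \<Longrightarrow> h < e \<Longrightarrow> g' 0 < g' h"
      using DERIV_pos_inc_right[OF g'_deriv] by force
    define r where "r = min d e / 2"
    have r: "0 < r" "r < d" "r < e" using d e by (auto simp: r_def)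
    have "g 0 < g r"
    proof (rule DERIV_pos_imp_increasing_open[OF r(1)])
      fix x assume "0 < x" "x < r"
      then show "\<exists>y. (g has_real_derivative y) (at x) \<and> 0 < y"
        using g_deriv[of x] e(2)[of x] crit r by (intro exI[of _ "g' x"]) auto
    next
      show "continuous_on {0..r} g"
        using r by (intro continuous_at_imp_continuous_on) (auto intro!: DERIV_isCont g_deriv)
    qed
    then show False using g_max[of r] r by simp
  qed
qed

lemma maximizer_pos:
  assumes p: "p \<in> mean_field_maximizers \<beta>" and \<beta>: "0 \<le> \<beta>"
  shows "0 < p $ i"
proof (rule ccontr)
  have pv: "prob_vector p" using p by (simp add: mean_field_maximizers_def)
  assume "\<not> 0 < p $ i"
  then have i: "p $ i = 0" using prob_vectorD(1)[OF pv, of i] by simp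
  have "\<exists>j. p $ j \<noteq> 0" using prob_vectorD(2)[OF pv] by (metis sum.neutral zero_neq_one)
  then obtain j where j: "p $ j \<noteq> 0" by blast
  then have "0 < p $ j" using prob_vectorD(1)[OF pv, of j] by simp
  then obtain x y where xy: "0 \<le> x" "0 \<le> y" "x + y = p $ j"
    "site \<beta> 0 + site \<beta> (p $ j) < site \<beta> x + site \<beta> y"
    using site_spread_improves \<beta> by blast
  have "i \<noteq> j" using i j by auto
  from maximizer_pair[OF p this xy(1,2)] show False using xy i by simp
qed

lemma maximizer_critical:
  assumes p: "p \<in> mean_field_maximizers \<beta>" and \<beta>: "0 \<le> \<beta>"
  shows "ln (p $ i) - \<beta> * p $ i = ln (p $ j) - \<beta> * p $ j"
proof (cases "i = j")
  case False
  show ?thesis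
    by (rule site_interior(1)[OF maximizer_pos[OF p \<beta>] maximizer_pos[OF p \<beta>] maximizer_pair[OF p False]])
qed simp

lemma maximizer_second_order:
  assumes p: "p \<in> mean_field_maximizers \<beta>" and \<beta>: "0 \<le> \<beta>" and "i \<noteq> j"
  shows "2 * \<beta> \<le> 1 / p $ i + 1 / p $ j"
  by (rule site_interior(2)[OF maximizer_pos[OF p \<beta>] maximizer_pos[OF p \<beta>] maximizer_pair[OF p \<open>i \<noteq> j\<close>]])

lemma maximizer_large_coordinate:
  assumes p: "p \<in> mean_field_maximizers \<beta>" and \<beta>: "0 \<le> \<beta>" and less: "p $ k < p $ i"
  shows "1 / p $ i < \<beta>"
proof -
  note pos = maximizer_pos[OF p \<beta>]
  have "\<exists>z. p $ k < z \<and> z < p $ i \<and> ln (p $ i) - ln (p $ k) = (p $ i - p $ k) * (1 / z)"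
    by (rule MVT2[OF less]) (use pos[of k] in \<open>auto intro!: derivative_eq_intros\<close>)
  then obtain z where z: "p $ k < z" "z < p $ i" "ln (p $ i) - ln (p $ k) = (p $ i - p $ k) * (1 / z)"
    by blast
  have "(p $ i - p $ k) * (1 / z) = (p $ i - p $ k) * \<beta>"
    using maximizer_critical[OF p \<beta>, of i k] z(3) by (simp add: algebra_simps)
  then have "1 / z = \<beta>" using less by (subst (asm) mult_cancel_left) simp
  moreover have "1 / p $ i < 1 / z" using z pos[of k] by (simp add: frac_less2)
  ultimately show ?thesis by simp
qed

text \<open>At most one coordinate of a maximizer exceeds the minimum: two of them would both be larger than
  \<open>1/\<beta>\<close>, against the second order condition.\<close>

lemma maximizer_two_large:
  assumes p: "p \<in> mean_field_maximizers \<beta>" and \<beta>: "0 \<le> \<beta>"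
    and "p $ k < p $ i" "p $ k < p $ j"
  shows "i = j"
proof (rule ccontr)
  assume "i \<noteq> j"
  then show False
    using maximizer_second_order[OF p \<beta>, of i j] maximizer_large_coordinate[OF p \<beta> assms(3)]
      maximizer_large_coordinate[OF p \<beta> assms(4)] by linarith
qed

text \<open>The probability vector proportional to \<open>u\<close> at \<open>k\<close> and to \<open>1\<close> elsewhere; \<open>peak k 1\<close> is uniform.\<close>

definition peak :: "3 \<Rightarrow> real \<Rightarrow> real ^ 3" where
  "peak k u = (\<chi> i. (if i = k then u else 1) / (u + 2))"

lemma sum_peak:
  fixes k :: 3 and f :: "real \<Rightarrow> real"
  shows "(\<Sum>i\<in>UNIV. f (peak k u $ i)) = f (u / (u + 2)) + 2 * f (1 / (u + 2))"
proof -
  have "(\<Sum>i\<in>UNIV. f (peak k u $ i))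
    = f (u / (u + 2)) + (\<Sum>i\<in>UNIV - {k}. f (1 / (u + 2)))"
    by (subst sum.remove[of _ k]) (auto simp: peak_def intro!: sum.cong)
  then show ?thesis by (simp add: card_Diff_singleton)
qed

lemma peak_total:
  assumes "0 \<le> u"
  shows "u / (u + 2) + 2 * (1 / (u + 2)) = (1::real)"
  using assms by (simp flip: add_divide_distrib)

lemma prob_vector_peak:
  assumes "0 \<le> u"
  shows "prob_vector (peak k u)"
  using assms sum_peak[of "\<lambda>x. x" k u] peak_total[OF assms]
  by (simp add: prob_vector_def) (simp add: peak_def)

lemma mean_field_peak:
  assumes "0 < u"
  shows "mean_field \<beta> (peak k u)
    = ln (u + 2) - u / (u + 2) * ln u + \<beta> / 2 * ((u\<^sup>2 + 2) / (u + 2)\<^sup>2)"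
proof -
  have "shannon (peak k u)
    = - (u / (u + 2) * ln u) + (u / (u + 2) + 2 * (1 / (u + 2))) * ln (u + 2)"
    using assms unfolding shannon_def sum_peak[where f = "\<lambda>x. x * ln x"]
    by (simp add: ln_div algebra_simps)
  also have "\<dots> = ln (u + 2) - u / (u + 2) * ln u" using peak_total[of u] assms by simp
  finally show ?thesis
    by (simp add: mean_field_def sum_peak[where f = "\<lambda>x. x\<^sup>2"] power_divide add_divide_distrib)
qed

lemma mean_field_peak_gap:
  assumes "1 < u"
  shows "mean_field (potts_beta u) (peak k u) - mean_field (potts_beta u) (peak k 1) = potts_gap u"
proof -
  have "potts_beta u / 2 * ((u\<^sup>2 + 2) / (u + 2)\<^sup>2) - potts_beta u / 2 * (1 / 3)
    = potts_beta u / 2 * (2 * (u - 1)\<^sup>2 / (3 * (u + 2)\<^sup>2))"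
    using assms by (simp add: divide_simps) (simp add: algebra_simps power2_eq_square)
  also have "\<dots> = (u - 1) / (3 * (u + 2)) * ln u"
    using assms by (simp add: potts_beta_def divide_simps) (simp add: algebra_simps power2_eq_square)
  finally have e: "potts_beta u / 2 * ((u\<^sup>2 + 2) / (u + 2)\<^sup>2) - potts_beta u / 2 * (1 / 3)
    = (u - 1) / (3 * (u + 2)) * ln u" .
  have "(2 * u + 1) / (3 * (u + 2)) = u / (u + 2) - (u - 1) / (3 * (u + 2))"
    using assms by (simp add: divide_simps) (simp add: algebra_simps)
  then have "(2 * u + 1) / (3 * (u + 2)) * ln u = u / (u + 2) * ln u - (u - 1) / (3 * (u + 2)) * ln u"
    by (simp add: left_diff_distrib)
  moreover have "ln ((u + 2) / 3) = ln (u + 2) - ln 3" using assms by (simp add: ln_div)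
  ultimately show ?thesis
    using assms e by (simp add: mean_field_peak potts_gap_def)
qed

lemma peak_1: "peak k 1 = (\<chi> i. 1 / 3)"
  by (simp add: peak_def vec_eq_iff)

lemma maximizer_is_peak:
  assumes p: "p \<in> mean_field_maximizers \<beta>" and \<beta>: "0 \<le> \<beta>"
  obtains "p = peak 1 1" | k u where "1 < u" "\<beta> = potts_beta u" "p = peak k u"
proof -
  have pv: "prob_vector p" using p by (simp add: mean_field_maximizers_def)
  define m where "m = Min (range (($) p))"
  have "m \<in> range (($) p)" unfolding m_def by (rule Min_in) auto
  then obtain l where l: "m = p $ l" by blast
  have le: "p $ l \<le> p $ i" for i unfolding l[symmetric] m_def by simp
  show thesis
  proof (cases "\<forall>i. p $ i = p $ l")
    case True
    then have all: "p $ i = p $ l" for i by blast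
    have "(\<Sum>i\<in>UNIV. p $ i) = (\<Sum>i\<in>(UNIV :: 3 set). p $ l)" by (rule sum.cong[OF refl all])
    then have pl: "p $ l = 1 / 3" using prob_vectorD(2)[OF pv] by simp
    have "p $ i = 1 / 3" for i using all[of i] pl by simp
    then have "p = peak 1 1" by (simp add: vec_eq_iff peak_1)
    then show ?thesis by (rule that(1))
  next
    case False
    then obtain k where "p $ k \<noteq> p $ l" by blast
    then have k: "p $ l < p $ k" using le[of k] by simp
    have others: "p $ i = p $ l" if "i \<noteq> k" for i
      using maximizer_two_large[OF p \<beta> k, of i] le[of i] that by force
    have pos: "0 < p $ l" by (rule maximizer_pos[OF p \<beta>])
    define u where "u = p $ k / p $ l"
    have u: "1 < u" and pk: "p $ k = u * p $ l" using k pos by (auto simp: u_def)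
    have "1 = p $ k + (\<Sum>i\<in>UNIV - {k}. p $ l)"
      using prob_vectorD(2)[OF pv] by (subst (asm) sum.remove[of _ k]) (auto simp: others)
    then have "1 = (u + 2) * p $ l" by (simp add: pk card_Diff_singleton algebra_simps)
    then have pl: "p $ l = 1 / (u + 2)" using u by (simp add: field_simps)
    have pe: "p = peak k u" using others pk pl by (simp add: peak_def vec_eq_iff)
    have "ln u = \<beta> * (p $ k - p $ l)"
      using maximizer_critical[OF p \<beta>, of k l] pos u by (simp add: pk ln_mult algebra_simps)
    then have "ln u = \<beta> * ((u - 1) / (u + 2))" by (simp add: pk pl diff_divide_distrib)
    then have "\<beta> = potts_beta u" using u by (simp add: potts_beta_def field_simps)
    with u pe show ?thesis by (intro that(2))
  qed
qed

section \<open>The nonlinear pressure\<close>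

text \<open>Splitting off the initial letter of a word.\<close>

lemma sum_length_Suc:
  fixes f :: "'a::finite list \<Rightarrow> real"
  shows "(\<Sum>x | length x = Suc n. f x) = (\<Sum>k\<in>UNIV. \<Sum>y | length y = n. f (k # y))"
proof -
  have "{x :: 'a list. length x = Suc n} = (\<lambda>(k, y). k # y) ` (UNIV \<times> {y. length y = n})"
    by (auto simp: image_iff length_Suc_conv)
  then have "(\<Sum>x | length x = Suc n. f x)
    = sum (f \<circ> (\<lambda>(k, y). k # y)) (UNIV \<times> {y. length y = n})"
    by (simp add: sum.reindex inj_on_def)
  also have "\<dots> = (\<Sum>k\<in>UNIV. \<Sum>y | length y = n. f (k # y))"
    by (simp add: sum.cartesian_product split_def)
  finally show ?thesis .
qed

lemma sum_words_prod:
  fixes w :: "'a::finite \<Rightarrow> real"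
  shows "(\<Sum>x | length x = n. \<Prod>j<n. w (x ! j)) = (\<Sum>k\<in>UNIV. w k) ^ n"
proof (induction n)
  case (Suc n)
  have "(\<Sum>x | length x = Suc n. \<Prod>j<Suc n. w (x ! j))
    = (\<Sum>k\<in>UNIV. \<Sum>y | length y = n. w k * (\<Prod>j<n. w (y ! j)))"
    by (subst sum_length_Suc) (simp add: prod.lessThan_Suc_shift del: prod.lessThan_Suc)
  also have "\<dots> = (\<Sum>k\<in>UNIV. w k) * (\<Sum>k\<in>UNIV. w k) ^ n"
    by (simp add: Suc.IH flip: sum_distrib_left sum_distrib_right)
  finally show ?case by simp
qed simp

lemma paths_full_T: "paths full_T n = {x. length x = Suc n}"
  by (simp add: paths_def full_T_def)

lemma finite_paths: "finite (paths full_T n)"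
  using finite_lists_length_eq[of "UNIV :: 3 set" "Suc n"] by (simp add: paths_full_T)

text \<open>The frequencies of the letters \<open>x ! 1, \<dots>, x ! n\<close> in a path of length \<open>n\<close>; the initial letter \<open>x ! 0\<close>
  is not counted.\<close>

definition letter_freq :: "nat \<Rightarrow> 'n::finite list \<Rightarrow> real ^ 'n" where
  "letter_freq n x = second_marginal (empirical n x)"

lemma letter_freq_nth:
  "letter_freq n x $ k = real (card {j. j < n \<and> x ! Suc j = k}) / real n"
proof -
  have "letter_freq n x $ k
    = (1 / real n) * (\<Sum>i\<in>UNIV. \<Sum>j<n. if (x ! j, x ! Suc j) = (i, k) then 1 else 0)"
    by (simp add: letter_freq_def second_marginal_def empirical_def axis_def sum_distrib_left
        if_distrib cong: if_cong)
      (simp add: eq_commute conj_commute)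
  also have "(\<Sum>i\<in>UNIV. \<Sum>j<n. if (x ! j, x ! Suc j) = (i, k) then 1 else 0)
    = (\<Sum>j<n. if x ! Suc j = k then 1 else (0::real))"
    by (subst sum.swap, rule sum.cong) auto
  also have "\<dots> = real (card {j. j < n \<and> x ! Suc j = k})"
    by (simp add: sum.If_cases lessThan_def Int_def)
  finally show ?thesis by simp
qed

lemma sum_letter_freq:
  assumes "0 < n"
  shows "real n * (\<Sum>k\<in>UNIV. v k * letter_freq n x $ k) = (\<Sum>j<n. v (x ! Suc j))"
proof -
  have "real n * (\<Sum>k\<in>UNIV. v k * letter_freq n x $ k)
    = (\<Sum>k\<in>UNIV. \<Sum>j<n. if x ! Suc j = k then v k else 0)"
    using assms
    by (simp add: letter_freq_nth sum_distrib_left sum.If_cases lessThan_def Int_def mult.commute)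
  also have "\<dots> = (\<Sum>j<n. v (x ! Suc j))"
    by (subst sum.swap) simp
  finally show ?thesis .
qed

text \<open>The functional \<open>G\<^sub>\<beta>\<close>: the exponential growth rate of the partition function with the energy
  linearized at \<open>v\<close>; see \<open>sum_paths_tilt\<close>.\<close>

definition dual_mean_field :: "real \<Rightarrow> real ^ 'n::finite \<Rightarrow> real" where
  "dual_mean_field \<beta> v = ln (\<Sum>k\<in>UNIV. exp (\<beta> * v $ k)) - \<beta> / 2 * (\<Sum>k\<in>UNIV. (v $ k)\<^sup>2)"

text \<open>The tangent at \<open>v\<close> of \<open>q \<mapsto> \<beta>/2 |q|\<^sup>2\<close>, evaluated at \<open>q\<close>; it is a lower bound for \<open>\<beta> \<ge> 0\<close>.\<close>

definition tilt :: "real \<Rightarrow> real ^ 'n::finite \<Rightarrow> real ^ 'n \<Rightarrow> real" where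
  "tilt \<beta> v q = (\<Sum>k\<in>UNIV. \<beta> * v $ k * q $ k) - \<beta> / 2 * (\<Sum>k\<in>UNIV. (v $ k)\<^sup>2)"

lemma sum_exp_pos: "0 < (\<Sum>k\<in>UNIV. exp (f k :: real))" for f :: "'n::finite \<Rightarrow> real"
  by (intro sum_pos) auto

lemma tilt_le:
  assumes "0 \<le> \<beta>"
  shows "tilt \<beta> v q \<le> \<beta> / 2 * (\<Sum>k\<in>UNIV. (q $ k)\<^sup>2)"
proof -
  have "0 \<le> \<beta> / 2 * (\<Sum>k\<in>UNIV. (q $ k - v $ k)\<^sup>2)"
    using assms by (intro mult_nonneg_nonneg sum_nonneg) auto
  also have "\<dots> = \<beta> / 2 * (\<Sum>k\<in>UNIV. (q $ k)\<^sup>2) - tilt \<beta> v q"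
    by (simp add: tilt_def power2_diff sum.distrib sum_subtractf sum_distrib_left algebra_simps
        sum_divide_distrib)
  finally show ?thesis by simp
qed

lemma tilt_self: "tilt \<beta> q q = \<beta> / 2 * (\<Sum>k\<in>UNIV. (q $ k)\<^sup>2)"
proof -
  have "(\<Sum>k\<in>UNIV. \<beta> * q $ k * q $ k) = \<beta> * (\<Sum>k\<in>UNIV. (q $ k)\<^sup>2)"
    by (simp add: sum_distrib_left power2_eq_square mult.assoc)
  then show ?thesis by (simp add: tilt_def)
qed

lemma mean_field_le_dual:
  assumes "prob_vector p"
  shows "mean_field \<beta> p \<le> dual_mean_field \<beta> p"
proof -
  define Z where "Z = (\<Sum>k\<in>UNIV. exp (\<beta> * p $ k))"
  have Z: "0 < Z" unfolding Z_def by (rule sum_exp_pos)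
  define w where "w = (\<chi> k. exp (\<beta> * p $ k) / Z)"
  have "prob_vector w" using Z by (simp add: prob_vector_def w_def Z_def flip: sum_divide_distrib)
  moreover have "0 < w $ k" for k using Z by (simp add: w_def)
  ultimately have "shannon p \<le> - (\<Sum>k\<in>UNIV. p $ k * ln (w $ k))"
    by (rule gibbs_inequality[OF assms])
  also have "\<dots> = - (\<Sum>k\<in>UNIV. p $ k * (\<beta> * p $ k - ln Z))"
    using Z by (simp add: w_def ln_div)
  also have "\<dots> = ln Z - \<beta> * (\<Sum>k\<in>UNIV. (p $ k)\<^sup>2)"
    using prob_vectorD(2)[OF assms]
    by (simp add: right_diff_distrib sum_subtractf power2_eq_square sum_distrib_left mult.left_commute
        flip: sum_distrib_right)
  finally show ?thesis by (simp add: mean_field_def dual_mean_field_def Z_def)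
qed

text \<open>The witness is the Gibbs vector proportional to \<open>exp (\<beta> v\<^sub>k)\<close>, for which the variational formula for
  \<open>ln \<Sum> exp (\<beta> v\<^sub>k)\<close> is an equality.\<close>

lemma dual_le_mean_field:
  fixes v :: "real ^ 'n::finite"
  assumes "0 \<le> \<beta>"
  shows "\<exists>p :: real ^ 'n. prob_vector p \<and> dual_mean_field \<beta> v \<le> mean_field \<beta> p"
proof -
  define Z where "Z = (\<Sum>k\<in>UNIV. exp (\<beta> * v $ k))"
  have Z: "0 < Z" unfolding Z_def by (rule sum_exp_pos)
  define p where "p = (\<chi> k. exp (\<beta> * v $ k) / Z)"
  have p: "prob_vector p" using Z by (simp add: prob_vector_def p_def Z_def flip: sum_divide_distrib)
  have "shannon p = - (\<Sum>k\<in>UNIV. p $ k * (\<beta> * v $ k - ln Z))"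
    using Z by (simp add: shannon_def p_def ln_div)
  also have "\<dots> = ln Z - (\<Sum>k\<in>UNIV. \<beta> * v $ k * p $ k)"
    using prob_vectorD(2)[OF p]
    by (simp add: right_diff_distrib sum_subtractf mult.commute flip: sum_distrib_left)
  finally have "dual_mean_field \<beta> v = shannon p + tilt \<beta> v p"
    by (simp add: dual_mean_field_def tilt_def Z_def)
  also have "\<dots> \<le> mean_field \<beta> p" using tilt_le[OF assms] by (simp add: mean_field_def)
  finally show ?thesis using p by blast
qed

text \<open>For a linear energy the letters decouple; the factor \<open>3\<close> counts the initial letters.\<close>

lemma sum_paths_tilt:
  assumes "0 < n"
  shows "(\<Sum>x\<in>paths full_T n. exp (real n * tilt \<beta> v (letter_freq n x)))
    = 3 * exp (real n * dual_mean_field \<beta> v)"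
proof -
  define S where "S = (\<Sum>k\<in>UNIV. (v $ k)\<^sup>2)"
  have "exp (real n * tilt \<beta> v (letter_freq n x))
    = exp (- real n * (\<beta> / 2 * S)) * (\<Prod>j<n. exp (\<beta> * v $ (x ! Suc j)))" for x
    using sum_letter_freq[OF assms, of "\<lambda>k. \<beta> * v $ k" x]
    by (simp add: tilt_def S_def right_diff_distrib flip: exp_sum exp_add)
  then have "(\<Sum>x\<in>paths full_T n. exp (real n * tilt \<beta> v (letter_freq n x)))
    = exp (- real n * (\<beta> / 2 * S)) * (\<Sum>x | length x = Suc n. \<Prod>j<n. exp (\<beta> * v $ (x ! Suc j)))"
    by (simp add: paths_full_T sum_distrib_left)
  also have "\<dots> = exp (- real n * (\<beta> / 2 * S)) * (3 * (\<Sum>k\<in>UNIV. exp (\<beta> * v $ k)) ^ n)"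
    by (subst sum_length_Suc) (simp add: sum_words_prod[where w = "\<lambda>k. exp (\<beta> * v $ k)"])
  also have "(\<Sum>k\<in>UNIV. exp (\<beta> * v $ k)) ^ n = exp (real n * ln (\<Sum>k\<in>UNIV. exp (\<beta> * v $ k)))"
    using sum_exp_pos[of "\<lambda>k. \<beta> * v $ k"] by (simp add: exp_of_nat_mult)
  also have "exp (- real n * (\<beta> / 2 * S)) * (3 * exp (real n * ln (\<Sum>k\<in>UNIV. exp (\<beta> * v $ k))))
    = 3 * exp (- real n * (\<beta> / 2 * S) + real n * ln (\<Sum>k\<in>UNIV. exp (\<beta> * v $ k)))"
    by (simp only: exp_add mult.left_commute)
  also have "- real n * (\<beta> / 2 * S) + real n * ln (\<Sum>k\<in>UNIV. exp (\<beta> * v $ k))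
    = real n * dual_mean_field \<beta> v"
    by (simp add: dual_mean_field_def S_def right_diff_distrib)
  finally show ?thesis .
qed

lemma card_letter_freq:
  assumes "0 < n"
  shows "card (letter_freq n ` paths full_T n) \<le> (n + 1) ^ 3"
proof -
  let ?F = "PiE (UNIV :: 3 set) (\<lambda>_. {..n})"
  let ?g = "\<lambda>c. \<chi> k. real (c k) / real n"
  have "letter_freq n ` paths full_T n \<subseteq> ?g ` ?F"
  proof
    fix q assume "q \<in> letter_freq n ` paths full_T n"
    then obtain x where q: "q = letter_freq n x" by blast
    define c where "c k = card {j. j < n \<and> x ! Suc j = k}" for k
    have "c k \<le> card {..<n}" for k unfolding c_def by (rule card_mono) auto
    then have "c \<in> ?F" by auto
    moreover have "q = ?g c" by (simp add: q vec_eq_iff letter_freq_nth c_def)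
    ultimately show "q \<in> ?g ` ?F" by blast
  qed
  then have "card (letter_freq n ` paths full_T n) \<le> card (?g ` ?F)"
    by (intro card_mono finite_imageI finite_PiE) auto
  also have "\<dots> \<le> card ?F" by (intro card_image_le finite_PiE) auto
  also have "\<dots> = (n + 1) ^ 3" by (simp add: card_PiE)
  finally show ?thesis .
qed

lemma pressure_seq_potts:
  fixes p :: "real ^ 3"
  assumes \<beta>: "0 \<le> \<beta>" and p: "p \<in> mean_field_maximizers \<beta>"
  shows "pressure_seq full_T (potts_energy \<beta>) \<longlonglongrightarrow> mean_field \<beta> p"
proof -
  define M where "M = mean_field \<beta> p"
  define Z where "Z n = (\<Sum>x\<in>paths full_T n. exp (real n * potts_energy \<beta> (empirical n x)))" for n
  have pv: "prob_vector p" using p by (simp add: mean_field_maximizers_def)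
  have energy: "potts_energy \<beta> (empirical n x) = \<beta> / 2 * (\<Sum>k\<in>UNIV. (letter_freq n x $ k)\<^sup>2)" for n x
    by (simp add: potts_energy_def letter_freq_def)
  have dual: "dual_mean_field \<beta> v \<le> M" for v :: "real ^ 3"
  proof -
    obtain w :: "real ^ 3" where w: "prob_vector w" "dual_mean_field \<beta> v \<le> mean_field \<beta> w"
      using dual_le_mean_field[OF \<beta>] by blast
    have "mean_field \<beta> w \<le> M" using p w(1) by (simp add: M_def mean_field_maximizers_def)
    with w(2) show ?thesis by simp
  qed
  have lower: "3 * exp (real n * M) \<le> Z n" if n: "0 < n" for n
  proof -
    have "3 * exp (real n * M) \<le> 3 * exp (real n * dual_mean_field \<beta> p)"
      using mean_field_le_dual[OF pv] by (simp add: M_def mult_left_mono)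
    also have "\<dots> = (\<Sum>x\<in>paths full_T n. exp (real n * tilt \<beta> p (letter_freq n x)))"
      by (simp add: sum_paths_tilt[OF n])
    also have "\<dots> \<le> Z n"
      unfolding Z_def energy
      by (intro sum_mono iffD2[OF exp_le_cancel_iff] mult_left_mono tilt_le[OF \<beta>]) simp
    finally show ?thesis .
  qed
  have upper: "Z n \<le> (real n + 1) ^ 3 * (3 * exp (real n * M))" if n: "0 < n" for n
  proof -
    let ?S = "letter_freq n ` paths full_T n"
    have fin: "finite ?S" by (intro finite_imageI finite_paths)
    \<comment> \<open>every path contributes exactly the tangent at its own frequency vector\<close>
    have "Z n = (\<Sum>x\<in>paths full_T n. exp (real n * tilt \<beta> (letter_freq n x) (letter_freq n x)))"
      unfolding Z_def energy tilt_self ..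
    also have "\<dots> \<le> (\<Sum>x\<in>paths full_T n. \<Sum>q\<in>?S. exp (real n * tilt \<beta> q (letter_freq n x)))"
      by (intro sum_mono member_le_sum[where f = "\<lambda>q. exp (real n * tilt \<beta> q (letter_freq n _))"]) (auto simp: fin)
    also have "\<dots> = (\<Sum>q\<in>?S. 3 * exp (real n * dual_mean_field \<beta> q))"
      by (subst sum.swap) (simp add: sum_paths_tilt[OF n])
    also have "\<dots> \<le> (\<Sum>q\<in>?S. 3 * exp (real n * M))"
      by (intro sum_mono) (simp add: dual mult_left_mono)
    also have "\<dots> = real (card ?S) * (3 * exp (real n * M))" by simp
    also have "\<dots> \<le> real ((n + 1) ^ 3) * (3 * exp (real n * M))"
      using card_letter_freq[OF n] by (intro mult_right_mono of_nat_mono) auto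
    finally show ?thesis by (simp add: add.commute)
  qed
  have pos: "0 < Z n" if "0 < n" for n
    using lower[OF that] exp_gt_zero[of "real n * M"] by linarith
  have "\<forall>\<^sub>F n in sequentially. ln 3 / real n + M \<le> pressure_seq full_T (potts_energy \<beta>) n"
    using eventually_gt_at_top[of 0]
  proof eventually_elim
    case (elim n)
    have "ln (3 * exp (real n * M)) \<le> ln (Z n)" using lower[OF elim] pos[OF elim] by simp
    then have "(ln 3 + real n * M) / real n \<le> ln (Z n) / real n"
      by (intro divide_right_mono) (auto simp: ln_mult)
    then show ?case using elim by (simp add: pressure_seq_def Z_def add_divide_distrib)
  qed
  moreover have "\<forall>\<^sub>F n in sequentially. pressure_seq full_T (potts_energy \<beta>) n
      \<le> (3 * ln (real n + 1) + ln 3) / real n + M"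
    using eventually_gt_at_top[of 0]
  proof eventually_elim
    case (elim n)
    have "ln (Z n) \<le> ln ((real n + 1) ^ 3 * (3 * exp (real n * M)))"
      using upper[OF elim] pos[OF elim] by simp
    also have "\<dots> = 3 * ln (real n + 1) + ln 3 + real n * M"
      by (simp add: ln_mult ln_realpow)
    finally have "ln (Z n) / real n \<le> (3 * ln (real n + 1) + ln 3 + real n * M) / real n"
      by (intro divide_right_mono) auto
    then show ?case using elim by (simp add: pressure_seq_def Z_def add_divide_distrib)
  qed
  moreover have "(\<lambda>n. ln 3 / real n + M) \<longlonglongrightarrow> M" by real_asymp
  moreover have "(\<lambda>n. (3 * ln (real n + 1) + ln 3) / real n + M) \<longlonglongrightarrow> M" by real_asymp
  ultimately show ?thesis unfolding M_def by (rule tendsto_sandwich)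
qed

lemma nonlinear_pressure_potts:
  fixes p :: "real ^ 3"
  assumes "0 \<le> \<beta>" "p \<in> mean_field_maximizers \<beta>"
  shows "nonlinear_pressure full_T (potts_energy \<beta>) = mean_field \<beta> p"
  unfolding nonlinear_pressure_def by (rule limI[OF pressure_seq_potts[OF assms]])

section \<open>The phase transition\<close>

lemma mean_field_shift:
  "mean_field \<beta>' p = mean_field \<beta> p + (\<beta>' - \<beta>) / 2 * (\<Sum>i\<in>UNIV. (p $ i)\<^sup>2)"
  by (simp add: mean_field_def field_simps)

lemma mean_field_peak_site:
  assumes "0 < u"
  shows "mean_field \<beta> (peak k u) = mean_field \<beta> (peak l u)"
  by (simp add: mean_field_peak[OF assms])

lemma maximizers_transfer:
  fixes p q :: "real ^ 'n::finite"
  assumes "p \<in> mean_field_maximizers \<beta>" "prob_vector q" "mean_field \<beta> q = mean_field \<beta> p"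
  shows "q \<in> mean_field_maximizers \<beta>"
  using assms by (auto simp: mean_field_maximizers_def)

lemma mean_field_le_maximizer:
  fixes p q :: "real ^ 'n::finite"
  assumes "p \<in> mean_field_maximizers \<beta>" "prob_vector q"
  shows "mean_field \<beta> q \<le> mean_field \<beta> p"
  using assms by (simp add: mean_field_maximizers_def)

text \<open>A critical peak with \<open>1 < u < 4\<close> has a smaller value than the uniform vector.\<close>

lemma maximizer_peak_ge_4:
  assumes p: "peak k u \<in> mean_field_maximizers (potts_beta u)" and u: "1 < u"
  shows "4 \<le> u"
proof (rule ccontr)
  assume "\<not> 4 \<le> u"
  then have "potts_gap u < 0" using u potts_gap_neg by simp
  then show False
    using mean_field_le_maximizer[OF p prob_vector_peak[of 1 k]] mean_field_peak_gap[OF u, of k] by simp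
qed

lemma peak_1_eq: "peak k 1 = peak l 1"
  by (simp add: peak_1)

lemma maximizers_subcritical:
  assumes "0 \<le> \<beta>" "\<beta> < 4 * ln 2"
  shows "mean_field_maximizers \<beta> = {peak 1 1}"
proof -
  have "p = peak 1 1" if p: "p \<in> mean_field_maximizers \<beta>" for p
  proof (rule maximizer_is_peak[OF p assms(1)])
    fix k u assume u: "1 < u" "\<beta> = potts_beta u" "p = peak k u"
    have "4 \<le> u" using maximizer_peak_ge_4[of k u] u p by simp
    then have "4 * ln 2 \<le> \<beta>"
      using potts_beta_strict_mono[of 4 u] potts_beta_4 u(2) by (cases "u = 4") auto
    then show ?thesis using assms(2) by simp
  qed
  then show ?thesis using mean_field_maximizer_exists[where 'n = 3, of \<beta>] by blast
qed

lemma maximizers_critical: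
  "mean_field_maximizers (4 * ln 2) = insert (peak 1 1) (range (\<lambda>k. peak k 4))"
proof -
  have eq: "mean_field (4 * ln 2) (peak k 4) = mean_field (4 * ln 2) (peak 1 1)" for k
    using mean_field_peak_gap[of 4 k] unfolding potts_beta_4 potts_gap_4 peak_1_eq[of k 1] by simp
  have sub: "p \<in> insert (peak 1 1) (range (\<lambda>k. peak k 4))"
    if p: "p \<in> mean_field_maximizers (4 * ln 2)" for p
  proof (rule maximizer_is_peak[OF p])
    fix k u assume u: "1 < u" "4 * ln 2 = potts_beta u" "p = peak k u"
    have "4 \<le> u" using maximizer_peak_ge_4[of k u] u p by simp
    then have "u = 4"
      using potts_beta_strict_mono[of 4 u] potts_beta_4 u(2) by force
    then show ?thesis using u by simp
  qed auto
  obtain p :: "real ^ 3" where p: "p \<in> mean_field_maximizers (4 * ln 2)"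
    using mean_field_maximizer_exists by blast
  have "mean_field (4 * ln 2) p = mean_field (4 * ln 2) (peak 1 1)"
    using sub[OF p] eq by auto
  then have "q \<in> mean_field_maximizers (4 * ln 2)"
    if "q \<in> insert (peak 1 1) (range (\<lambda>k. peak k 4))" for q
    using that eq by (intro maximizers_transfer[OF p]) (auto intro: prob_vector_peak)
  with sub show ?thesis by blast
qed

lemma maximizers_supercritical:
  assumes "4 * ln 2 < \<beta>"
  shows "mean_field_maximizers \<beta> = range (\<lambda>k. peak k (potts_u \<beta>))"
proof -
  note u0 = potts_u_root[OF assms]
  have \<beta>: "0 \<le> \<beta>" using less_trans[OF _ assms, of 0] by simp
  have sub: "p \<in> range (\<lambda>k. peak k (potts_u \<beta>))" if p: "p \<in> mean_field_maximizers \<beta>" for p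
  proof (rule maximizer_is_peak[OF p \<beta>])
    assume "p = peak 1 1"
    then show ?thesis
      using mean_field_le_maximizer[OF p prob_vector_peak[of "potts_u \<beta>" 1]] u0
        mean_field_peak_gap[of "potts_u \<beta>" 1] potts_gap_pos[OF u0(1)] by simp
  next
    fix k u assume u: "1 < u" "\<beta> = potts_beta u" "p = peak k u"
    have "4 \<le> u" using maximizer_peak_ge_4[of k u] u p by simp
    moreover have "u \<noteq> 4" using u(2) assms potts_beta_4 by auto
    ultimately have "u = potts_u \<beta>" using potts_u_unique[of u] u(2) by simp
    then show ?thesis using u by simp
  qed
  obtain p :: "real ^ 3" where p: "p \<in> mean_field_maximizers \<beta>"
    using mean_field_maximizer_exists by blast
  obtain l where l: "p = peak l (potts_u \<beta>)" using sub[OF p] by blast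
  have "peak k (potts_u \<beta>) \<in> mean_field_maximizers \<beta>" for k
  proof (rule maximizers_transfer[OF p])
    show "prob_vector (peak k (potts_u \<beta>))" using u0(1) by (intro prob_vector_peak) simp
    show "mean_field \<beta> (peak k (potts_u \<beta>)) = mean_field \<beta> p"
      unfolding l using u0(1) by (intro mean_field_peak_site) simp
  qed
  then have super: "range (\<lambda>k. peak k (potts_u \<beta>)) \<subseteq> mean_field_maximizers \<beta>" by auto
  show ?thesis by (rule equalityI[OF subsetI[OF sub] super])
qed

lemma peak_eqD:
  assumes "0 \<le> u" "u \<noteq> 1" "peak k u = peak l u"
  shows "k = l"
proof (rule ccontr)
  assume "k \<noteq> l"
  have "peak k u $ k = peak l u $ k" using assms(3) by simp
  with \<open>k \<noteq> l\<close> assms(1,2) show False by (simp add: peak_def)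
qed

lemma card_peaks:
  assumes "0 \<le> u" "u \<noteq> 1"
  shows "card (range (\<lambda>k. peak k u)) = 3"
  using peak_eqD[OF assms] by (subst card_image) (auto simp: inj_on_def)

text \<open>The permutations of \<open>(u, 1, 1)/(u + 2)\<close> are determined by the position of \<open>u\<close>.\<close>

lemma vec_perms_peaks:
  "vec_perms (vector [u / (u + 2), 1 / (u + 2), 1 / (u + 2)]) = range (\<lambda>k. peak k u)"
proof -
  define v :: "real ^ 3" where "v = vector [u / (u + 2), 1 / (u + 2), 1 / (u + 2)]"
  have "\<forall>i. v $ i = (if i = 1 then u else 1) / (u + 2)"
    by (simp add: v_def forall_3 vector_3)
  then have v: "v $ i = (if i = 1 then u else 1) / (u + 2)" for i by blast
  have perm: "(\<chi> i. v $ \<pi> i) = peak (inv \<pi> 1) u" if "\<pi> permutes UNIV" for \<pi>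
  proof -
    have "\<pi> i = 1 \<longleftrightarrow> i = inv \<pi> 1" for i
      using permutes_inv_eq[OF that, of 1 i] by auto
    then show ?thesis by (simp add: vec_eq_iff v peak_def)
  qed
  show ?thesis
    unfolding v_def[symmetric]
  proof (intro set_eqI iffI)
    fix x assume "x \<in> vec_perms v"
    then show "x \<in> range (\<lambda>k. peak k u)" by (auto simp: vec_perms_def perm)
  next
    fix x assume "x \<in> range (\<lambda>k. peak k u)"
    then obtain k where x: "x = peak k u" by blast
    have "Transposition.transpose 1 k permutes (UNIV :: 3 set)" by (rule permutes_swap_id) auto
    moreover from perm[OF this] have "x = (\<chi> i. v $ Transposition.transpose 1 k i)" by (simp add: x)
    ultimately show "x \<in> vec_perms v" unfolding vec_perms_def by blast
  qed
qed

lemma vec_perms_critical: "vec_perms (vector [2/3, 1/6, 1/6]) = range (\<lambda>k. peak k 4)"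
  using vec_perms_peaks[of 4] by simp

lemma pressure_subcritical:
  assumes "0 \<le> \<beta>" "\<beta> \<le> 4 * ln 2"
  shows "nonlinear_pressure full_T (potts_energy \<beta>) = ln 3 + \<beta> / 6"
proof -
  have "peak 1 1 \<in> mean_field_maximizers \<beta>"
    using maximizers_subcritical[of \<beta>] maximizers_critical assms by (cases "\<beta> = 4 * ln 2") auto
  from nonlinear_pressure_potts[OF assms(1) this] show ?thesis
    by (simp add: mean_field_peak)
qed

lemma pressure_supercritical:
  assumes "4 * ln 2 < \<beta>"
  shows "nonlinear_pressure full_T (potts_energy \<beta>) = mean_field \<beta> (peak k (potts_u \<beta>))"
proof (rule nonlinear_pressure_potts)
  show "0 \<le> \<beta>" using less_trans[OF _ assms, of 0] by simp
  show "peak k (potts_u \<beta>) \<in> mean_field_maximizers \<beta>" by (simp add: maximizers_supercritical[OF assms])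
qed

lemma pressure_left_derivative:
  "((\<lambda>\<beta>. nonlinear_pressure full_T (potts_energy \<beta>)) has_real_derivative 1/6) (at_left (4 * ln 2))"
proof -
  have "\<forall>\<^sub>F \<beta> in at_left (4 * ln 2). \<beta> \<in> {0<..<4 * ln 2 :: real}"
    by (rule eventually_at_leftI) auto
  then have "\<forall>\<^sub>F \<beta> in at_left (4 * ln 2).
      1 / 6 = (nonlinear_pressure full_T (potts_energy \<beta>)
        - nonlinear_pressure full_T (potts_energy (4 * ln 2))) / (\<beta> - 4 * ln 2)"
    by eventually_elim (simp add: pressure_subcritical field_simps)
  then show ?thesis
    unfolding has_field_derivative_iff by (rule tendsto_eventually[OF eventually_mono]) simp
qed

lemma sum_squares_peak: "(\<Sum>i\<in>UNIV. (peak k u $ i)\<^sup>2) = (u\<^sup>2 + 2) / (u + 2)\<^sup>2"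
  by (simp add: sum_peak[where f = "\<lambda>x. x\<^sup>2"] power_divide add_divide_distrib)

text \<open>Comparing maximizers at the two temperatures bounds the difference quotient between half the sums
  of squares of \<open>(4, 1, 1)/6\<close> and of \<open>(u, 1, 1)/(u + 2)\<close> for \<open>u = potts_u \<beta>\<close>, and \<open>u\<close> tends to \<open>4\<close>.\<close>

lemma pressure_right_derivative:
  "((\<lambda>\<beta>. nonlinear_pressure full_T (potts_energy \<beta>)) has_real_derivative 1/4) (at_right (4 * ln 2))"
proof -
  let ?c = "4 * ln 2 :: real"
  let ?P = "\<lambda>\<beta>. nonlinear_pressure full_T (potts_energy \<beta>)"
  let ?s = "\<lambda>u :: real. (u\<^sup>2 + 2) / (u + 2)\<^sup>2"
  have c: "peak 1 4 \<in> mean_field_maximizers ?c" by (simp add: maximizers_critical)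
  have Pc: "?P ?c = mean_field ?c (peak 1 4)" by (rule nonlinear_pressure_potts[OF _ c]) simp
  have bounds: "1 / 4 \<le> (?P \<beta> - ?P ?c) / (\<beta> - ?c) \<and> (?P \<beta> - ?P ?c) / (\<beta> - ?c) \<le> ?s (potts_u \<beta>) / 2"
    if \<beta>: "?c < \<beta>" for \<beta>
  proof -
    let ?p = "peak 1 (potts_u \<beta>)"
    have m: "?p \<in> mean_field_maximizers \<beta>" by (simp add: maximizers_supercritical[OF \<beta>])
    have P: "?P \<beta> = mean_field \<beta> ?p" by (rule pressure_supercritical[OF \<beta>])
    have "mean_field \<beta> (peak 1 4) \<le> ?P \<beta>"
      unfolding P by (rule mean_field_le_maximizer[OF m prob_vector_peak]) simp
    moreover have "mean_field \<beta> (peak 1 4) = ?P ?c + (\<beta> - ?c) / 4"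
      using mean_field_shift[of \<beta> "peak 1 4" ?c] by (simp add: Pc sum_squares_peak)
    ultimately have "(\<beta> - ?c) / 4 \<le> ?P \<beta> - ?P ?c" by linarith
    moreover have "mean_field ?c ?p \<le> ?P ?c"
      unfolding Pc using potts_u_root(1)[OF \<beta>] by (intro mean_field_le_maximizer[OF c prob_vector_peak]) simp
    then have "?P \<beta> - ?P ?c \<le> (\<beta> - ?c) / 2 * ?s (potts_u \<beta>)"
      unfolding P mean_field_shift[of \<beta> ?p ?c] sum_squares_peak by linarith
    ultimately show ?thesis using \<beta> by (simp add: pos_le_divide_eq pos_divide_le_eq mult.commute)
  qed
  have "((\<lambda>\<beta>. ?s (potts_u \<beta>) / 2) \<longlongrightarrow> ?s 4 / 2) (at_right ?c)"
    by (intro tendsto_intros potts_u_tendsto) auto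
  then have upper: "((\<lambda>\<beta>. ?s (potts_u \<beta>) / 2) \<longlongrightarrow> 1 / 4) (at_right ?c)" by simp
  show ?thesis
    unfolding has_field_derivative_iff
    by (rule tendsto_sandwich[OF _ _ tendsto_const upper]; 
        rule eventually_mono[OF eventually_at_right_less]) (use bounds in auto)
qed

theorem proposition7p5:
  fixes \<beta>\<^sub>c :: real and p_dis :: "real ^ 3" and \<Psi> :: "real \<Rightarrow> real"
  assumes beta_c: "\<beta>\<^sub>c = 4 * ln 2"
    and p_dis: "p_dis = vector [1/3, 1/3, 1/3]"
    and Psi: "\<Psi> = (\<lambda>\<beta>. nonlinear_pressure full_T (potts_energy \<beta>))"
  shows "rotation_set full_T potts_psi = {(p1, p2). 0 \<le> p1 \<and> 0 \<le> p2 \<and> p1 + p2 \<le> 1}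
    \<and> critical_inverse_temperature full_T potts_energy \<beta>\<^sub>c
    \<and> (\<forall>\<beta>. 0 \<le> \<beta> \<and> \<beta> < \<beta>\<^sub>c \<longrightarrow> equilibrium_vectors full_T (potts_energy \<beta>) = {p_dis})
    \<and> (equilibrium_vectors full_T (potts_energy \<beta>\<^sub>c)
         = insert p_dis (vec_perms (vector [2/3, 1/6, 1/6]))
       \<and> card (equilibrium_vectors full_T (potts_energy \<beta>\<^sub>c)) = 4
       \<and> card (vec_perms (vector [2/3, 1/6, 1/6] :: real ^ 3)) = 3)
    \<and> (\<forall>\<beta>. \<beta>\<^sub>c < \<beta> \<longrightarrow>
         (\<exists>!u. 4 < u \<and> \<beta> = (u + 2) * ln u / (u - 1))
         \<and> (let u = potts_u \<beta>; a = u / (u + 2); b = 1 / (u + 2) in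
              equilibrium_vectors full_T (potts_energy \<beta>) = vec_perms (vector [a, b, b]))
         \<and> card (equilibrium_vectors full_T (potts_energy \<beta>)) = 3)
    \<and> (\<forall>\<beta> p. 0 \<le> \<beta> \<and> p \<in> equilibrium_vectors full_T (potts_energy \<beta>) \<longrightarrow>
         (p, product_kernel p) \<in> equilibrium_pairs full_T (potts_energy \<beta>)
         \<and> second_marginal (two_coordinate p (product_kernel p)) = p
         \<and> (\<forall>\<mu> Q. (\<mu>, Q) \<in> equilibrium_pairs full_T (potts_energy \<beta>)
               \<and> second_marginal (two_coordinate \<mu> Q) = p \<longrightarrow>
             ((\<mu>, Q), (p, product_kernel p)) \<in> ae_equal
             \<and> (\<forall>i j. two_coordinate \<mu> Q $ (i, j) = p $ i * p $ j)))
    \<and> (\<forall>\<beta>\<ge>0. convergent (pressure_seq full_T (potts_energy \<beta>)))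
    \<and> (\<forall>\<beta>. 0 \<le> \<beta> \<and> \<beta> \<le> \<beta>\<^sub>c \<longrightarrow> \<Psi> \<beta> = ln 3 + \<beta> / 6)
    \<and> (\<forall>\<beta>. \<beta>\<^sub>c < \<beta> \<longrightarrow>
         (let u = potts_u \<beta> in
            \<Psi> \<beta> = ln (u + 2) - u / (u + 2) * ln u + \<beta> / 2 * ((u\<^sup>2 + 2) / (u + 2)\<^sup>2)))
    \<and> (\<Psi> has_real_derivative 1/6) (at_left \<beta>\<^sub>c)
    \<and> (\<Psi> has_real_derivative 1/4) (at_right \<beta>\<^sub>c)
    \<and> first_order_transition \<Psi> \<beta>\<^sub>c"
proof (intro conjI)
  have dis: "p_dis = peak 1 1"
    by (simp add: p_dis peak_1 vec_eq_iff forall_3 vector_3)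
  have dis_notin: "peak 1 1 \<notin> range (\<lambda>k. peak k 4)"
  proof
    assume "peak 1 1 \<in> range (\<lambda>k. peak k 4)"
    then obtain k where "peak 1 1 = peak k 4" by blast
    then have "peak 1 1 $ k = peak k 4 $ k" by simp
    then show False by (simp add: peak_def split: if_splits)
  qed
  let ?class = "\<lambda>p :: real ^ 3. ae_equal `` {(p, product_kernel p)}"
  show "rotation_set full_T potts_psi = {(p1, p2). 0 \<le> p1 \<and> 0 \<le> p2 \<and> p1 + p2 \<le> 1}"
    by (rule rotation_set_potts)
  show "critical_inverse_temperature full_T potts_energy \<beta>\<^sub>c"
    unfolding critical_inverse_temperature_def beta_c
  proof (intro conjI allI impI)
    fix \<beta> :: real assume "0 \<le> \<beta> \<and> \<beta> < 4 * ln 2"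
    then show "is_singleton (equilibrium_pairs full_T (potts_energy \<beta>) // ae_equal)"
      by (simp add: equilibrium_classes maximizers_subcritical)
  next
    fix \<beta> :: real assume \<beta>: "4 * ln 2 < \<beta>"
    have "peak 1 (potts_u \<beta>) \<noteq> peak 2 (potts_u \<beta>)"
      using peak_eqD[of "potts_u \<beta>" 1 2] potts_u_root(1)[OF \<beta>] by auto
    then have "?class (peak 1 (potts_u \<beta>)) \<noteq> ?class (peak 2 (potts_u \<beta>))"
      unfolding inj_eq[OF inj_product_kernel_class] .
    then show "\<exists>c \<in> equilibrium_pairs full_T (potts_energy \<beta>) // ae_equal.
        \<exists>c' \<in> equilibrium_pairs full_T (potts_energy \<beta>) // ae_equal. c \<noteq> c'"
      unfolding equilibrium_classes maximizers_supercritical[OF \<beta>]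
      by (intro bexI[where x = "?class (peak 1 (potts_u \<beta>))"]
          bexI[where x = "?class (peak 2 (potts_u \<beta>))"] imageI rangeI)
  qed simp
  show "\<forall>\<beta>. 0 \<le> \<beta> \<and> \<beta> < \<beta>\<^sub>c \<longrightarrow> equilibrium_vectors full_T (potts_energy \<beta>) = {p_dis}"
    by (simp add: equilibrium_vectors_potts maximizers_subcritical beta_c dis)
  show "equilibrium_vectors full_T (potts_energy \<beta>\<^sub>c) = insert p_dis (vec_perms (vector [2/3, 1/6, 1/6]))"
    by (simp only: equilibrium_vectors_potts maximizers_critical beta_c dis vec_perms_critical)
  show "card (equilibrium_vectors full_T (potts_energy \<beta>\<^sub>c)) = 4"
    using dis_notin by (simp add: equilibrium_vectors_potts maximizers_critical beta_c card_peaks)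
  show "card (vec_perms (vector [2/3, 1/6, 1/6] :: real ^ 3)) = 3"
    unfolding vec_perms_critical by (simp add: card_peaks)
  show "\<forall>\<beta>. \<beta>\<^sub>c < \<beta> \<longrightarrow>
         (\<exists>!u. 4 < u \<and> \<beta> = (u + 2) * ln u / (u - 1))
         \<and> (let u = potts_u \<beta>; a = u / (u + 2); b = 1 / (u + 2) in
              equilibrium_vectors full_T (potts_energy \<beta>) = vec_perms (vector [a, b, b]))
         \<and> card (equilibrium_vectors full_T (potts_energy \<beta>)) = 3"
    unfolding beta_c Let_def equilibrium_vectors_potts vec_perms_peaks
  proof (intro allI impI conjI)
    fix \<beta> :: real assume \<beta>: "4 * ln 2 < \<beta>"
    show "\<exists>!u. 4 < u \<and> \<beta> = (u + 2) * ln u / (u - 1)" by (rule potts_beta_ex1[OF \<beta>])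
    show "mean_field_maximizers \<beta> = range (\<lambda>k. peak k (potts_u \<beta>))"
      by (rule maximizers_supercritical[OF \<beta>])
    then show "card (mean_field_maximizers \<beta> :: (real ^ 3) set) = 3"
      using potts_u_root(1)[OF \<beta>] by (simp add: card_peaks)
  qed
  show "\<forall>\<beta> p. 0 \<le> \<beta> \<and> p \<in> equilibrium_vectors full_T (potts_energy \<beta>) \<longrightarrow>
         (p, product_kernel p) \<in> equilibrium_pairs full_T (potts_energy \<beta>)
         \<and> second_marginal (two_coordinate p (product_kernel p)) = p
         \<and> (\<forall>\<mu> Q. (\<mu>, Q) \<in> equilibrium_pairs full_T (potts_energy \<beta>)
               \<and> second_marginal (two_coordinate \<mu> Q) = p \<longrightarrow>
             ((\<mu>, Q), (p, product_kernel p)) \<in> ae_equal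
             \<and> (\<forall>i j. two_coordinate \<mu> Q $ (i, j) = p $ i * p $ j))"
  proof (intro allI impI; elim conjE)
    fix \<beta> p assume "p \<in> equilibrium_vectors full_T (potts_energy \<beta>)"
    then have p: "p \<in> mean_field_maximizers \<beta>" by (simp add: equilibrium_vectors_potts)
    have eq: "(p, product_kernel p) \<in> equilibrium_pairs full_T (potts_energy \<beta>)"
      by (rule product_pair_in_equilibrium[OF p])
    have marg: "second_marginal (two_coordinate p (product_kernel p)) = p"
      using eq by (auto simp: equilibrium_pairs_potts intro: second_marginal_two_coordinate)
    have uniq: "((\<mu>, Q), (p, product_kernel p)) \<in> ae_equal
             \<and> (\<forall>i j. two_coordinate \<mu> Q $ (i, j) = p $ i * p $ j)"
      if h: "(\<mu>, Q) \<in> equilibrium_pairs full_T (potts_energy \<beta>)"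
        "second_marginal (two_coordinate \<mu> Q) = p" for \<mu> Q
    proof -
      have "\<mu> = p"
        using h by (auto simp: equilibrium_pairs_potts second_marginal_two_coordinate)
      with h have ae: "((\<mu>, Q), (p, product_kernel p)) \<in> ae_equal"
        by (simp add: equilibrium_pairs_potts)
      have "two_coordinate \<mu> Q $ (i, j) = p $ i * p $ j" for i j
        using ae \<open>\<mu> = p\<close>
        by (cases "p $ i = 0") (auto simp: two_coordinate_def ae_equal_def product_kernel_def)
      with ae show ?thesis by blast
    qed
    show "(p, product_kernel p) \<in> equilibrium_pairs full_T (potts_energy \<beta>)
         \<and> second_marginal (two_coordinate p (product_kernel p)) = p
         \<and> (\<forall>\<mu> Q. (\<mu>, Q) \<in> equilibrium_pairs full_T (potts_energy \<beta>)
               \<and> second_marginal (two_coordinate \<mu> Q) = p \<longrightarrow>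
             ((\<mu>, Q), (p, product_kernel p)) \<in> ae_equal
             \<and> (\<forall>i j. two_coordinate \<mu> Q $ (i, j) = p $ i * p $ j))"
      using eq marg uniq by blast
  qed
  show "\<forall>\<beta>\<ge>0. convergent (pressure_seq full_T (potts_energy \<beta>))"
    using pressure_seq_potts mean_field_maximizer_exists unfolding convergent_def by blast
  show "\<forall>\<beta>. 0 \<le> \<beta> \<and> \<beta> \<le> \<beta>\<^sub>c \<longrightarrow> \<Psi> \<beta> = ln 3 + \<beta> / 6"
    by (simp add: Psi beta_c pressure_subcritical)
  show "\<forall>\<beta>. \<beta>\<^sub>c < \<beta> \<longrightarrow>
         (let u = potts_u \<beta> in
            \<Psi> \<beta> = ln (u + 2) - u / (u + 2) * ln u + \<beta> / 2 * ((u\<^sup>2 + 2) / (u + 2)\<^sup>2))"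
    unfolding Let_def beta_c Psi
  proof (intro allI impI)
    fix \<beta> :: real assume \<beta>: "4 * ln 2 < \<beta>"
    then have "0 < potts_u \<beta>" using potts_u_root(1) by force
    then show "nonlinear_pressure full_T (potts_energy \<beta>)
      = ln (potts_u \<beta> + 2) - potts_u \<beta> / (potts_u \<beta> + 2) * ln (potts_u \<beta>)
        + \<beta> / 2 * (((potts_u \<beta>)\<^sup>2 + 2) / (potts_u \<beta> + 2)\<^sup>2)"
      by (simp only: pressure_supercritical[OF \<beta>, of 1] mean_field_peak)
  qed
  show L: "(\<Psi> has_real_derivative 1/6) (at_left \<beta>\<^sub>c)"
    unfolding Psi beta_c by (rule pressure_left_derivative)
  show R: "(\<Psi> has_real_derivative 1/4) (at_right \<beta>\<^sub>c)"
    unfolding Psi beta_c by (rule pressure_right_derivative)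
  show "first_order_transition \<Psi> \<beta>\<^sub>c"
    unfolding first_order_transition_def using L R by (intro exI[of _ "1/6"] exI[of _ "1/4"]) simp
qed

end
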